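(* For every $a\in\mathbb{R}$ there exists a heteroclinic connection of the system (S) between the points $p_{-}=(1,0,0,-\tfrac{\pi}{2})$ and $p_{+}=(1,0,0,\tfrac{\pi}{2})$, i.e. a solution $(\Phi,W,\Psi,\theta)(\tau)$ of (S) defined for all $\tau\in\mathbb{R}$ with $\lim_{\tau\to-\infty}(\Phi,W,\Psi,\theta)(\tau)=p_{-}$ and $\lim_{\tau\to+\infty}(\Phi,W,\Psi,\theta)(\tau)=p_{+}$.
   Context: For $a\in\mathbb{R}$, (S) denotes the autonomous system, for $(\Phi,W,\Psi,\theta)(\tau)\in\mathbb{R}^{+}\times\mathbb{R}^{2}\times[-\pi/2,\pi/2]$, $$\frac{d\Phi}{d\tau}=W,\qquad \frac{dW}{d\tau}=\Psi,$$ $$\frac{d\Psi}{d\tau}=\frac{1}{\Phi^{3}}-1-(a-1)(\cos\theta)^{2}-\Big[\Big(\tfrac{16}{3}\sin\theta-\tfrac{224}{27}(\sin\theta)^{3}\Big)(\cos\theta)^{\frac{17}{3}}\Phi+\Big(\tfrac{208}{81}(\sin\theta)^{2}-\tfrac{10}{9}\Big)(\cos\theta)^{\frac{34}{9}}W+\tfrac{2}{3}\sin\theta(\cos\theta)^{\frac{17}{9}}\Psi\Big],$$ $$\frac{d\theta}{d\tau}=(\cos\theta)^{\frac{26}{9}}.$$ The points $p_{\pm}$ are critical points of (S). *)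

theory Defs
  imports "HOL-Analysis.Analysis"
begin

type_synonym state = "real \<times> real \<times> real \<times> real"

definition phase_space :: "state set" where
  "phase_space = {0<..} \<times> UNIV \<times> UNIV \<times> {- pi / 2 .. pi / 2}"

(* On phase_space the base cos \<theta> is nonnegative, so the real powers are the usual ones;
   at \<theta> = -pi/2, pi/2 they vanish, in agreement with 0 powr r = 0. *)
definition vector_field :: "real \<Rightarrow> state \<Rightarrow> state" where
  "vector_field a = (\<lambda>(\<Phi>, W, \<Psi>, \<theta>).
     (W,
      \<Psi>,
      1 / \<Phi> ^ 3 - 1 - (a - 1) * (cos \<theta>) ^ 2
        - ((16 / 3 * sin \<theta> - 224 / 27 * (sin \<theta>) ^ 3) * (cos \<theta> powr (17 / 3)) * \<Phi>
           + (208 / 81 * (sin \<theta>) ^ 2 - 10 / 9) * (cos \<theta> powr (34 / 9)) * W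
           + 2 / 3 * sin \<theta> * (cos \<theta> powr (17 / 9)) * \<Psi>),
      cos \<theta> powr (26 / 9)))"

definition global_solution :: "real \<Rightarrow> (real \<Rightarrow> state) \<Rightarrow> bool" where
  "global_solution a x \<longleftrightarrow>
     (\<forall>\<tau>. x \<tau> \<in> phase_space \<and> (x has_vector_derivative vector_field a (x \<tau>)) (at \<tau>))"

definition p_minus :: state where
  "p_minus = (1, 0, 0, - pi / 2)"

definition p_plus :: state where
  "p_plus = (1, 0, 0, pi / 2)"

definition heteroclinic_connection :: "real \<Rightarrow> (real \<Rightarrow> state) \<Rightarrow> state \<Rightarrow> state \<Rightarrow> bool" where
  "heteroclinic_connection a x p q \<longleftrightarrow>
     global_solution a x \<and> (x \<longlongrightarrow> p) at_bot \<and> (x \<longlongrightarrow> q) at_top"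

end

theory Submission
  imports Defs "HOL-Real_Asymp.Real_Asymp"
begin

text \<open>
The system is a compactified scalar equation. With \<open>x = tan \<theta>\<close>, \<open>\<Phi> = (1 + x^2) powr (1/3) * H x\<close> and
\<open>dx/d\<tau> = (1 + x^2) powr (-4/9)\<close> it becomes

  \<open>H''' = 1 / H^3 - (a + x^2)\<close>,

and a heteroclinic connection is a positive solution on the whole line that follows
\<open>(1 + x^2) powr (-1/3)\<close>, together with two derivatives, at both ends.

The existence proof rests on one structural fact. The third derivative is skew-symmetric and
\<open>u \<mapsto> -1/u^3\<close> is increasing, so the equation is governed by a monotone operator: for the
difference \<open>h\<close> of \<open>H\<close> and a comparison function the expression \<open>h * h'' - h'^2 / 2\<close> has
derivative \<open>h * h'''\<close>, which is negative up to an error made by the comparison function. This yields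
an a priori bound that does not see the length of the interval.

In detail: the singular nonlinearity is replaced by a globally Lipschitz, still decreasing one,
equal to \<open>1/u^3\<close> for \<open>u \<ge> \<delta>\<close>, where \<open>u\<close> stands for the rescaled unknown \<open>\<Phi>\<close>.
On \<open>[-L, L]\<close> one prescribes \<open>H(L)\<close>, \<open>H'(L)\<close> and \<open>H(-L)\<close>, the boundary conditions that give the boundary terms of the energy a good sign. Solutions with the same
\<open>H(L)\<close> and \<open>H'(L)\<close> are ordered by \<open>H''(L)\<close>, so that the problem is solved by shooting and the
intermediate value theorem (\<open>boundary_value_problem\<close>). The energy bound (\<open>boundary_value_energy\<close>)
requires a positive comparison function \<open>G\<close> with \<open>G''' + a + x^2 > 0\<close>, which \<open>reference_profile\<close>
supplies for every real \<open>a\<close>. The bound is turned into a pointwise one with an explicit decay rate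
(\<open>window_estimate\<close>), and into a positive lower bound that makes the truncation invisible
(\<open>no_touchdown\<close>). As all constants are independent of \<open>L\<close>, the initial values at \<open>0\<close> of
solutions that obey the bounds on \<open>[-n, n]\<close> form nested nonempty compact sets in three-dimensional
space, and a common point of these sets starts the solution on the line (\<open>entire_solution\<close>).
\<close>

section \<open>Ordinary differential equations with time-dependent Lipschitz constants\<close>

text \<open>Antiderivatives replace integrals throughout: all estimates below compare a function with one
whose derivative dominates, so that no integral has to be evaluated and no orientation of the
interval to be tracked.\<close>

lemma antiderivative_on_line:
  fixes g :: "real \<Rightarrow> 'a::euclidean_space"
  assumes "continuous_on UNIV g"
  obtains A where "A t0 = 0" "\<And>t. (A has_vector_derivative g t) (at t)"
proof -
  have "isCont g x" for x
    using assms continuous_on_eq_continuous_at by blast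
  then obtain F where F: "\<And>x. (F has_vector_derivative g x) (at x)"
    using einterval_antiderivative[of "-\<infinity>" "\<infinity>" g] by auto
  show thesis
  proof (rule that[of "\<lambda>t. F t - F t0"])
    show "((\<lambda>t. F t - F t0) has_vector_derivative g t) (at t)" for t
      by (rule derivative_eq_intros F | simp)+
  qed simp
qed

lemma norm_increment_le:
  fixes f :: "real \<Rightarrow> 'a::real_normed_vector"
  assumes "a \<le> b"
    and f: "\<And>x. x \<in> {a..b} \<Longrightarrow> (f has_vector_derivative f' x) (at x)"
    and g: "\<And>x. x \<in> {a..b} \<Longrightarrow> (g has_real_derivative g' x) (at x)"
    and le: "\<And>x. x \<in> {a..b} \<Longrightarrow> norm (f' x) \<le> g' x"
  shows "norm (f b - f a) \<le> g b - g a"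
proof (cases "a = b")
  case False
  show ?thesis
  proof (rule differentiable_bound_general[where f' = f' and \<phi>' = g'])
    show "a < b" using False assms(1) by simp
    show "continuous_on {a..b} f"
      by (meson f has_vector_derivative_continuous continuous_at_imp_continuous_on)
    show "continuous_on {a..b} g"
      by (meson g DERIV_isCont continuous_at_imp_continuous_on)
  qed (use f g le in \<open>auto simp: has_real_derivative_iff_has_vector_derivative\<close>)
qed auto

text \<open>Banach's fixed point theorem on the whole line at once, without gluing local solutions: in the
weight \<open>exp \<bar>L\<bar>\<close>, where \<open>L\<close> is an antiderivative of twice a bound for the Lipschitz constant, the Picard operator
contracts by the factor \<open>1/2\<close>, however fast the Lipschitz constant grows in time.\<close>

theorem global_ivp_solution:
  fixes V :: "real \<Rightarrow> 'a::euclidean_space \<Rightarrow> 'a"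
  assumes cont: "continuous_on UNIV (\<lambda>(t, y). V t y)"
    and K: "continuous_on UNIV K"
    and lip: "\<And>t y z. norm (V t y - V t z) \<le> K t * norm (y - z)"
  obtains X where "X t0 = y0" "\<And>t. (X has_vector_derivative V t (X t)) (at t)"
proof -
  have K0: "K t \<ge> 0" for t
  proof -
    obtain b :: 'a where "b \<in> Basis" using nonempty_Basis by blast
    then have "norm b = 1" by simp
    with lip[of t b 0] show ?thesis
      by (metis diff_zero mult.right_neutral norm_ge_zero order_trans)
  qed
  \<comment> \<open>enlarging the rate by the size of \<open>V t 0\<close> makes the weight absorb the inhomogeneity as well\<close>
  define M where "M t = K t + norm (V t 0)" for t
  have cV: "continuous_on UNIV (\<lambda>t. V t (u t))" if "continuous_on UNIV u" for u
  proof -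
    have "continuous_on UNIV ((\<lambda>(t, y). V t y) \<circ> (\<lambda>t. (t, u t)))"
      by (rule continuous_on_compose) (auto intro!: continuous_intros that
        continuous_on_subset[OF cont])
    then show ?thesis by (simp add: o_def)
  qed
  have M: "continuous_on UNIV M"
    unfolding M_def by (intro continuous_intros K cV)
  obtain L where L0: "L t0 = 0" and L: "\<And>t. (L has_vector_derivative 2 * M t) (at t)"
    by (rule antiderivative_on_line[of "\<lambda>t. 2 * M t" t0]) (auto intro!: continuous_intros M)
  have LD: "(L has_real_derivative 2 * M t) (at t)" for t
    using L by (simp add: has_real_derivative_iff_has_vector_derivative)
  have M0: "M t \<ge> 0" for t
    unfolding M_def using K0[of t] by simp
  have Lpos: "L t \<ge> 0" if "t \<ge> t0" for t
    using DERIV_nonneg_imp_nondecreasing[of t0 t L] that LD M0 L0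
    by (metis mult_nonneg_nonneg zero_le_numeral)
  have Lneg: "L t \<le> 0" if "t \<le> t0" for t
    using DERIV_nonneg_imp_nondecreasing[of t t0 L] that LD M0 L0
    by (metis mult_nonneg_nonneg zero_le_numeral)
  define w where "w t = exp \<bar>L t\<bar>" for t
  have w1: "w t \<ge> 1" for t unfolding w_def by simp
  have nw: "norm (v /\<^sub>R w t) = norm v / w t" for v :: 'a and t
    using w1[of t] unfolding norm_scaleR divide_inverse by (simp add: mult.commute)
  have cL: "continuous_on UNIV L"
    by (meson LD DERIV_isCont continuous_at_imp_continuous_on)
  have cw: "continuous_on UNIV w"
    unfolding w_def by (intro continuous_intros cL)
  \<comment> \<open>the gain of \<open>1/2\<close>: away from \<open>t0\<close> the derivative of \<open>exp \<bar>L\<bar>\<close> is, up to sign,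
    \<open>2 * M\<close> times itself\<close>
  have weight: "norm (A t) \<le> D * (w t - 1) / 2"
    if A0: "A t0 = 0" and A: "\<And>s. (A has_vector_derivative g s) (at s)"
      and g: "\<And>s. norm (g s) \<le> M s * w s * D" for A :: "real \<Rightarrow> 'a" and g D t
  proof (cases "t \<ge> t0")
    case True
    have "norm (A t - A t0) \<le> D * exp (L t) / 2 - D * exp (L t0) / 2"
    proof (rule norm_increment_le[OF True A])
      show "((\<lambda>t. D * exp (L t) / 2) has_real_derivative M x * exp (L x) * D) (at x)" for x
        by (rule derivative_eq_intros LD refl | simp)+
      show "norm (g x) \<le> M x * exp (L x) * D" if "x \<in> {t0..t}" for x
        using g[of x] Lpos[of x] that by (simp add: w_def)
    qed
    then show ?thesis using A0 L0 Lpos[OF True] by (simp add: w_def right_diff_distrib diff_divide_distrib)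
  next
    case False
    then have F: "t \<le> t0" by simp
    have "norm (A t0 - A t) \<le> (- D * exp (- L t0) / 2) - (- D * exp (- L t) / 2)"
    proof (rule norm_increment_le[OF F A])
      show "((\<lambda>t. - D * exp (- L t) / 2) has_real_derivative M x * exp (- L x) * D) (at x)" for x
        by (rule derivative_eq_intros LD refl | simp)+
      show "norm (g x) \<le> M x * exp (- L x) * D" if "x \<in> {t..t0}" for x
        using g[of x] Lneg[of x] that by (simp add: w_def)
    qed
    then show ?thesis using A0 L0 Lneg[OF F] by (simp add: w_def right_diff_distrib diff_divide_distrib)
  qed
  define T where "T z = (SOME A. A t0 = 0 \<and> (\<forall>t. (A has_vector_derivative V t (w t *\<^sub>R apply_bcontfun z t)) (at t)))"
    for z :: "real \<Rightarrow>\<^sub>C 'a"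
  have T: "T z t0 = 0" "(T z has_vector_derivative V t (w t *\<^sub>R apply_bcontfun z t)) (at t)" for z t
  proof -
    have "continuous_on UNIV (\<lambda>t. V t (w t *\<^sub>R apply_bcontfun z t))"
      by (intro cV continuous_intros cw) auto
    then obtain A where "A t0 = 0" "\<And>t. (A has_vector_derivative V t (w t *\<^sub>R apply_bcontfun z t)) (at t)"
      using antiderivative_on_line by blast
    then have "\<exists>A. A t0 = 0 \<and> (\<forall>t. (A has_vector_derivative V t (w t *\<^sub>R apply_bcontfun z t)) (at t))"
      by blast
    from someI_ex[OF this] show "T z t0 = 0"
      "(T z has_vector_derivative V t (w t *\<^sub>R apply_bcontfun z t)) (at t)"
      unfolding T_def by blast+
  qed
  define S where "S z = (\<lambda>t. (y0 + T z t) /\<^sub>R w t)" for z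
  have S_b: "S z \<in> bcontfun" for z
  proof (rule bcontfun_normI)
    have "continuous_on UNIV (T z)"
      by (meson T(2) has_vector_derivative_continuous continuous_at_imp_continuous_on)
    then show "continuous_on UNIV (S z)"
      unfolding S_def using w1 by (intro continuous_intros cw) (metis not_one_le_zero)
    fix t
    have "norm (T z t) \<le> (1 + norm z) * (w t - 1) / 2"
    proof (rule weight[OF T])
      fix s
      have "norm (V s (w s *\<^sub>R apply_bcontfun z s)) \<le> norm (V s 0) + K s * norm (w s *\<^sub>R apply_bcontfun z s)"
        using lip[of s "w s *\<^sub>R apply_bcontfun z s" 0]
          norm_triangle_ineq2[of "V s (w s *\<^sub>R apply_bcontfun z s)" "V s 0"] by simp
      also have "\<dots> = norm (V s 0) * 1 + K s * (w s * norm (apply_bcontfun z s))"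
        using w1[of s] by simp
      also have "\<dots> \<le> norm (V s 0) * (w s * (1 + norm z)) + K s * (w s * (1 + norm z))"
      proof (intro add_mono mult_left_mono K0)
        show "1 \<le> w s * (1 + norm z)" using w1[of s] by (simp add: mult_ge1_I)
        show "norm (apply_bcontfun z s) \<le> 1 + norm z" using norm_bounded[of z s] by simp
      qed (use w1[of s] in auto)
      also have "\<dots> = M s * w s * (1 + norm z)" by (simp add: M_def algebra_simps)
      finally show "norm (V s (w s *\<^sub>R apply_bcontfun z s)) \<le> M s * w s * (1 + norm z)" .
    qed
    also have "\<dots> \<le> (1 + norm z) * w t"
      using w1[of t] by (simp add: field_simps add_nonneg_nonneg)
    finally have "norm (y0 + T z t) \<le> norm y0 * w t + (1 + norm z) * w t"
      using norm_triangle_ineq[of y0 "T z t"] w1[of t] mult_left_mono[of 1 "w t" "norm y0"] by simp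
    then have "norm (y0 + T z t) / w t \<le> norm y0 + (1 + norm z)"
      using w1[of t] by (simp add: field_simps)
    then show "norm (S z t) \<le> norm y0 + (1 + norm z)"
      by (simp add: S_def nw del: norm_scaleR)
  qed
  define P where "P z = Bcontfun (S z)" for z
  have P: "apply_bcontfun (P z) = S z" for z
    unfolding P_def using S_b by (simp add: Bcontfun_inverse)
  have "dist (P z1) (P z2) \<le> 1/2 * dist z1 z2" for z1 z2
  proof (rule dist_bound)
    fix t
    have "norm ((\<lambda>t. T z1 t - T z2 t) t) \<le> dist z1 z2 * (w t - 1) / 2"
    proof (rule weight)
      show "((\<lambda>t. T z1 t - T z2 t) has_vector_derivative
        V s (w s *\<^sub>R apply_bcontfun z1 s) - V s (w s *\<^sub>R apply_bcontfun z2 s)) (at s)" for s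
        by (intro derivative_intros T)
      fix s
      have "norm (V s (w s *\<^sub>R apply_bcontfun z1 s) - V s (w s *\<^sub>R apply_bcontfun z2 s))
          \<le> K s * norm (w s *\<^sub>R apply_bcontfun z1 s - w s *\<^sub>R apply_bcontfun z2 s)"
        by (rule lip)
      also have "\<dots> = K s * (w s * dist (apply_bcontfun z1 s) (apply_bcontfun z2 s))"
        using w1[of s] by (simp add: dist_norm flip: scaleR_right_diff_distrib)
      also have "\<dots> \<le> M s * (w s * dist z1 z2)"
        using w1[of s] K0[of s] by (intro mult_mono dist_bounded) (auto simp: M_def)
      finally show "norm (V s (w s *\<^sub>R apply_bcontfun z1 s) - V s (w s *\<^sub>R apply_bcontfun z2 s))
          \<le> M s * w s * dist z1 z2" by (simp add: mult.assoc)
    qed (simp add: T)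
    also have "\<dots> \<le> 1/2 * dist z1 z2 * w t" using w1[of t] by (simp add: field_simps)
    finally have "norm (T z1 t - T z2 t) / w t \<le> 1/2 * dist z1 z2"
      using w1[of t] by (simp add: field_simps)
    moreover have "S z1 t - S z2 t = (T z1 t - T z2 t) /\<^sub>R w t"
      by (simp add: S_def flip: scaleR_right_diff_distrib)
    ultimately show "dist (apply_bcontfun (P z1) t) (apply_bcontfun (P z2) t) \<le> 1/2 * dist z1 z2"
      by (simp add: P dist_norm nw del: norm_scaleR)
  qed
  then obtain z where z: "P z = z"
    using banach_fix_type[of "1/2" P] by auto
  define X where "X t = w t *\<^sub>R apply_bcontfun z t" for t
  have "X t = y0 + T z t" for t
  proof -
    have "w t *\<^sub>R apply_bcontfun z t = w t *\<^sub>R S z t" using P[of z] z by simp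
    then show ?thesis using w1[of t] by (simp add: X_def S_def)
  qed
  then have X: "X = (\<lambda>t. y0 + T z t)" by auto
  show thesis
  proof (rule that[of X])
    show "X t0 = y0" by (simp add: X T)
    have "(X has_vector_derivative V t (w t *\<^sub>R apply_bcontfun z t)) (at t)" for t
      unfolding X by (rule derivative_eq_intros T | simp)+
    then show "(X has_vector_derivative V t (X t)) (at t)" for t by (simp add: X_def)
  qed
qed

text \<open>Gronwall's inequality for the squared distance of two solutions. It gives uniqueness and
Lipschitz dependence on the data, here on both sides of \<open>t0\<close>.\<close>

theorem ivp_solutions_close:
  fixes V :: "real \<Rightarrow> 'a::euclidean_space \<Rightarrow> 'a"
  assumes K: "continuous_on UNIV K"
    and lip: "\<And>t y z. norm (V t y - V t z) \<le> K t * norm (y - z)"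
  obtains c where "\<And>X Y. (\<And>t. (X has_vector_derivative V t (X t)) (at t)) \<Longrightarrow>
      (\<And>t. (Y has_vector_derivative V t (Y t)) (at t)) \<Longrightarrow>
      norm (X t - Y t) \<le> c * norm (X t0 - Y t0)"
proof -
  obtain L where L0: "L t0 = 0" and L: "\<And>t. (L has_vector_derivative 2 * K t) (at t)"
    by (rule antiderivative_on_line[of "\<lambda>t. 2 * K t" t0]) (auto intro!: continuous_intros K)
  have LD: "(L has_real_derivative 2 * K t) (at t)" for t
    using L by (simp add: has_real_derivative_iff_has_vector_derivative)
  show thesis
  proof (rule that[of "exp (\<bar>L t\<bar> / 2)"])
    fix X Y assume X: "\<And>t. (X has_vector_derivative V t (X t)) (at t)"
      and Y: "\<And>t. (Y has_vector_derivative V t (Y t)) (at t)"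
    define d where "d t = X t - Y t" for t
    define d' where "d' t = V t (X t) - V t (Y t)" for t
    define n where "n t = d t \<bullet> d t" for t
    have d: "(d has_vector_derivative d' t) (at t)" for t
      unfolding d_def d'_def by (intro derivative_intros X Y)
    have n: "(n has_real_derivative 2 * (d t \<bullet> d' t)) (at t)" for t
    proof -
      have "(n has_vector_derivative (d t \<bullet> d' t + d' t \<bullet> d t)) (at t)"
        unfolding n_def
        by (rule bounded_bilinear.has_vector_derivative[OF bounded_bilinear_inner d d])
      then show ?thesis by (simp add: has_real_derivative_iff_has_vector_derivative inner_commute)
    qed
    have b: "\<bar>2 * (d s \<bullet> d' s)\<bar> \<le> 2 * K s * n s" for s
    proof -
      have "\<bar>d s \<bullet> d' s\<bar> \<le> norm (d s) * norm (d' s)" by (rule Cauchy_Schwarz_ineq2)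
      also have "\<dots> \<le> norm (d s) * (K s * norm (d s))"
        unfolding d'_def d_def by (intro mult_left_mono lip) auto
      also have "\<dots> = K s * n s"
        by (simp add: n_def dot_square_norm power2_eq_square)
      finally show ?thesis by (simp add: abs_mult)
    qed
    have "n t \<le> exp \<bar>L t\<bar> * n t0"
    proof (cases "t \<ge> t0")
      case True
      have "n t * exp (- L t) \<le> n t0 * exp (- L t0)"
      proof (rule DERIV_nonpos_imp_nonincreasing[OF True])
        fix s
        have "((\<lambda>t. n t * exp (- L t)) has_real_derivative
             (2 * (d s \<bullet> d' s) - 2 * K s * n s) * exp (- L s)) (at s)"
          by (rule derivative_eq_intros LD n refl | simp add: algebra_simps)+
        moreover have "(2 * (d s \<bullet> d' s) - 2 * K s * n s) * exp (- L s) \<le> 0"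
          using b[of s] by (intro mult_nonpos_nonneg) auto
        ultimately show "\<exists>y. ((\<lambda>t. n t * exp (- L t)) has_real_derivative y) (at s) \<and> y \<le> 0"
          by blast
      qed
      then have "n t \<le> n t0 * exp (L t)" by (simp add: L0 exp_minus field_simps)
      also have "\<dots> \<le> n t0 * exp \<bar>L t\<bar>"
        by (intro mult_left_mono) (auto simp: n_def)
      finally show ?thesis by (simp add: mult.commute)
    next
      case False
      then have F: "t \<le> t0" by simp
      have "n t * exp (L t) \<le> n t0 * exp (L t0)"
      proof (rule DERIV_nonneg_imp_nondecreasing[OF F])
        fix s
        have "((\<lambda>t. n t * exp (L t)) has_real_derivative
             (2 * (d s \<bullet> d' s) + 2 * K s * n s) * exp (L s)) (at s)"
          by (rule derivative_eq_intros LD n refl | simp add: algebra_simps)+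
        moreover have "(2 * (d s \<bullet> d' s) + 2 * K s * n s) * exp (L s) \<ge> 0"
          using b[of s] by (intro mult_nonneg_nonneg) auto
        ultimately show "\<exists>y. ((\<lambda>t. n t * exp (L t)) has_real_derivative y) (at s) \<and> y \<ge> 0"
          by blast
      qed
      then have "n t \<le> n t0 * exp (- L t)" by (simp add: L0 exp_minus field_simps)
      also have "\<dots> \<le> n t0 * exp \<bar>L t\<bar>"
        by (intro mult_left_mono) (auto simp: n_def)
      finally show ?thesis by (simp add: mult.commute)
    qed
    then have "(norm (d t))\<^sup>2 \<le> (exp (\<bar>L t\<bar> / 2) * norm (d t0))\<^sup>2"
      by (simp add: n_def dot_square_norm power_mult_distrib flip: exp_double)
    then have "norm (d t) \<le> exp (\<bar>L t\<bar> / 2) * norm (d t0)"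
      by (rule power2_le_imp_le) auto
    then show "norm (X t - Y t) \<le> exp (\<bar>L t\<bar> / 2) * norm (X t0 - Y t0)"
      by (simp add: d_def)
  qed
qed


section \<open>The truncated nonlinearity\<close>

text \<open>Below \<open>\<delta>\<close> the function \<open>1/u^3\<close> is continued by its tangent. This keeps it decreasing, convex and
positive, and makes it Lipschitz on the line.\<close>

definition trunc_inv_cube :: "real \<Rightarrow> real \<Rightarrow> real" where
  "trunc_inv_cube \<delta> u = (if u \<ge> \<delta> then 1 / u ^ 3 else 1 / \<delta> ^ 3 + 3 * (\<delta> - u) / \<delta> ^ 4)"

text \<open>The monotonicity defect with respect to the equilibrium \<open>u = 1\<close>. It is the quantity that the
energy controls: quadratic near \<open>1\<close>, linear at infinity, and comparable to the nonlinearity itself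
for small \<open>u\<close>, with constants independent of \<open>\<delta>\<close>.\<close>

definition excess :: "real \<Rightarrow> real \<Rightarrow> real" where
  "excess \<delta> u = (1 - trunc_inv_cube \<delta> u) * (u - 1)"

lemma inv_cube_diff:
  fixes u v \<delta> :: real
  assumes "0 < \<delta>" "\<delta> \<le> u" "u \<le> v"
  shows "0 \<le> 1 / u ^ 3 - 1 / v ^ 3" "1 / u ^ 3 - 1 / v ^ 3 \<le> 3 / \<delta> ^ 4 * (v - u)"
proof -
  have pos: "u > 0" "v > 0" using assms by auto
  show "0 \<le> 1 / u ^ 3 - 1 / v ^ 3"
    using pos assms by (simp add: frac_le power_mono)
  define p q d where "p = 1 / u" and "q = 1 / v" and "d = 1 / \<delta>"
  have le: "0 < q" "q \<le> p" "p \<le> d"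
    unfolding p_def q_def d_def using assms pos by (auto simp: frac_le)
  have "p - q = (v - u) * (p * q)" using pos by (simp add: p_def q_def field_simps)
  also have "\<dots> \<le> (v - u) * (d * d)"
    using le assms by (intro mult_left_mono mult_mono) auto
  finally have 1: "p - q \<le> (v - u) * (d * d)" .
  have "1 / u ^ 3 - 1 / v ^ 3 = p ^ 3 - q ^ 3" by (simp add: p_def q_def power_one_over)
  also have "\<dots> = (p - q) * (p * p + p * q + q * q)" by (simp add: algebra_simps power3_eq_cube)
  also have "\<dots> \<le> (v - u) * (d * d) * (d * d + d * d + d * d)"
    using 1 le assms by (intro mult_mono add_mono) auto
  also have "\<dots> = 3 / \<delta> ^ 4 * (v - u)"
    by (simp add: d_def power4_eq_xxxx algebra_simps)
  finally show "1 / u ^ 3 - 1 / v ^ 3 \<le> 3 / \<delta> ^ 4 * (v - u)" .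
qed

lemma trunc_inv_cube_diff:
  assumes "0 < \<delta>" "u \<le> v"
  shows "0 \<le> trunc_inv_cube \<delta> u - trunc_inv_cube \<delta> v"
    and "trunc_inv_cube \<delta> u - trunc_inv_cube \<delta> v \<le> 3 / \<delta> ^ 4 * (v - u)"
proof -
  consider "\<delta> \<le> u" | "u < \<delta>" "\<delta> \<le> v" | "v < \<delta>" using assms by linarith
  then have "0 \<le> trunc_inv_cube \<delta> u - trunc_inv_cube \<delta> v \<and>
    trunc_inv_cube \<delta> u - trunc_inv_cube \<delta> v \<le> 3 / \<delta> ^ 4 * (v - u)"
  proof cases
    case 1
    then show ?thesis using inv_cube_diff[of \<delta> u v] assms by (simp add: trunc_inv_cube_def)
  next
    case 2
    have "trunc_inv_cube \<delta> u - trunc_inv_cube \<delta> v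
        = 3 / \<delta> ^ 4 * (\<delta> - u) + (1 / \<delta> ^ 3 - 1 / v ^ 3)"
      using 2 by (simp add: trunc_inv_cube_def)
    moreover have "3 / \<delta> ^ 4 * (\<delta> - u) \<ge> 0" using 2 assms by simp
    moreover have "3 / \<delta> ^ 4 * (\<delta> - u) + 3 / \<delta> ^ 4 * (v - \<delta>) = 3 / \<delta> ^ 4 * (v - u)"
      by (simp add: algebra_simps flip: add_divide_distrib)
    ultimately show ?thesis using inv_cube_diff[of \<delta> \<delta> v] 2 assms by linarith
  next
    case 3
    have "trunc_inv_cube \<delta> u - trunc_inv_cube \<delta> v = 3 / \<delta> ^ 4 * (\<delta> - u) - 3 / \<delta> ^ 4 * (\<delta> - v)"
      using 3 assms by (simp add: trunc_inv_cube_def)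
    also have "\<dots> = 3 / \<delta> ^ 4 * (v - u)" by (simp add: algebra_simps flip: diff_divide_distrib)
    finally show ?thesis using 3 assms by simp
  qed
  then show "0 \<le> trunc_inv_cube \<delta> u - trunc_inv_cube \<delta> v"
    "trunc_inv_cube \<delta> u - trunc_inv_cube \<delta> v \<le> 3 / \<delta> ^ 4 * (v - u)" by auto
qed

lemma trunc_inv_cube_lipschitz:
  assumes "0 < \<delta>"
  shows "\<bar>trunc_inv_cube \<delta> u - trunc_inv_cube \<delta> v\<bar> \<le> 3 / \<delta> ^ 4 * \<bar>u - v\<bar>"
proof (cases "u \<le> v")
  case True
  then show ?thesis using trunc_inv_cube_diff[OF assms True] by simp
next
  case False
  then have "v \<le> u" by simp
  then show ?thesis using trunc_inv_cube_diff[OF assms \<open>v \<le> u\<close>] by simp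
qed

text \<open>Convexity: the graph lies above its tangent at \<open>1\<close>.\<close>

lemma trunc_inv_cube_ge_tangent:
  assumes "0 < \<delta>" "\<delta> \<le> 1" "u \<le> 1"
  shows "trunc_inv_cube \<delta> u - 1 \<ge> 3 * (1 - u)"
proof -
  have *: "1 / v ^ 3 - 1 \<ge> 3 * (1 - v)" if "0 < v" "v \<le> 1" for v :: real
  proof -
    have "3 * (1 - v) * v ^ 3 \<le> 1 - v ^ 3"
    proof -
      have "1 - v ^ 3 - 3 * (1 - v) * v ^ 3 = (1 - v) * ((1 + v + v\<^sup>2) - 3 * v ^ 3)"
        by (simp add: algebra_simps power2_eq_square power3_eq_cube)
      moreover have "v ^ 3 \<le> v\<^sup>2" "v\<^sup>2 \<le> v" "v \<le> 1"
        using that power_decreasing[of 2 3 v] power_decreasing[of 1 2 v] by auto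
      ultimately show ?thesis using that
        by (smt (verit, best) mult_nonneg_nonneg)
    qed
    then show ?thesis using that by (simp add: field_simps)
  qed
  show ?thesis
  proof (cases "u \<ge> \<delta>")
    case True
    then show ?thesis using *[of u] assms by (simp add: trunc_inv_cube_def)
  next
    case False
    have "\<delta> ^ 4 \<le> 1" using assms by (intro power_le_one) auto
    then have "3 * (\<delta> - u) * \<delta> ^ 4 \<le> 3 * (\<delta> - u) * 1"
      using False by (intro mult_left_mono) auto
    then have "3 * (\<delta> - u) \<le> 3 * (\<delta> - u) / \<delta> ^ 4"
      using assms by (simp add: le_divide_eq)
    then show ?thesis using *[of \<delta>] assms False by (simp add: trunc_inv_cube_def)
  qed
qed

lemma trunc_inv_cube_ge_1:
  assumes "\<delta> \<le> 1" "u \<ge> 1"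
  shows "trunc_inv_cube \<delta> u = 1 / u ^ 3" "0 < trunc_inv_cube \<delta> u" "trunc_inv_cube \<delta> u \<le> 1"
    "(u - 1) / u \<le> 1 - trunc_inv_cube \<delta> u" "1 - trunc_inv_cube \<delta> u \<le> 3 * (u - 1)"
proof -
  show e: "trunc_inv_cube \<delta> u = 1 / u ^ 3"
    using assms by (simp add: trunc_inv_cube_def)
  show "0 < trunc_inv_cube \<delta> u" "trunc_inv_cube \<delta> u \<le> 1"
    using assms by (simp_all add: e)
  have "1 / u ^ 3 \<le> 1 / u" using assms self_le_power[of u 3] by (simp add: frac_le)
  then show "(u - 1) / u \<le> 1 - trunc_inv_cube \<delta> u" using assms by (simp add: e diff_divide_distrib)
  show "1 - trunc_inv_cube \<delta> u \<le> 3 * (u - 1)"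
    using inv_cube_diff(2)[of 1 1 u] assms by (simp add: e)
qed

lemma excess_ge:
  assumes "0 < \<delta>" "\<delta> \<le> 1"
  shows "excess \<delta> u \<ge> (u - 1)\<^sup>2 / (1 + \<bar>u - 1\<bar>)"
proof (cases "u \<ge> 1")
  case True
  have "(u - 1) / u * (u - 1) \<le> (1 - trunc_inv_cube \<delta> u) * (u - 1)"
    using trunc_inv_cube_ge_1(4)[of \<delta> u] True assms by (intro mult_right_mono) auto
  then show ?thesis using True by (simp add: excess_def power2_eq_square)
next
  case False
  have "3 * (1 - u) * (1 - u) \<le> (trunc_inv_cube \<delta> u - 1) * (1 - u)"
    using trunc_inv_cube_ge_tangent[of \<delta> u] False assms by (intro mult_right_mono) auto
  then have "3 * (u - 1)\<^sup>2 \<le> excess \<delta> u"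
    by (simp add: excess_def power2_eq_square algebra_simps)
  moreover have "(u - 1)\<^sup>2 / (1 + \<bar>u - 1\<bar>) \<le> (u - 1)\<^sup>2 / 1"
    by (intro divide_left_mono) auto
  moreover have "0 \<le> (u - 1)\<^sup>2" by simp
  ultimately show ?thesis by linarith
qed

lemma excess_nonneg:
  assumes "0 < \<delta>" "\<delta> \<le> 1" shows "excess \<delta> u \<ge> 0"
  using excess_ge[OF assms, of u] by (smt (verit) divide_nonneg_nonneg zero_le_power2)

lemma trunc_inv_cube_le_excess:
  assumes "0 < \<delta>" "\<delta> \<le> 1"
  shows "trunc_inv_cube \<delta> u \<le> 8 + 2 * excess \<delta> u"
proof (cases "u \<ge> 1/2")
  case True
  have "trunc_inv_cube \<delta> u \<le> 8"
  proof (cases "\<delta> \<le> u")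
    case F: True
    have "1 / u ^ 3 \<le> 1 / (1/2) ^ 3" using True by (intro divide_left_mono power_mono) auto
    then show ?thesis using F by (simp add: trunc_inv_cube_def power_divide)
  next
    case False
    then have "\<delta> > 1/2" using True by simp
    have "3 * (\<delta> - u) + \<delta> \<le> 8 * \<delta> ^ 4"
    proof -
      have "3 * (\<delta> - u) + \<delta> \<le> 4 * \<delta> - 3/2" using True by simp
      also have "\<dots> \<le> 8 * \<delta> ^ 4"
      proof -
        define e where "e = \<delta> - 1/2"
        have d: "\<delta> = e + 1/2" "e \<ge> 0" using \<open>\<delta> > 1/2\<close> by (auto simp: e_def)
        have "8 * \<delta> ^ 4 - (4 * \<delta> - 3/2) = 8 * e ^ 4 + 16 * e ^ 3 + 12 * e\<^sup>2"
          unfolding d(1) by (simp add: power2_eq_square power3_eq_cube power4_eq_xxxx field_simps)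
        then show ?thesis using d(2) by (smt (verit) zero_le_power)
      qed
      finally show ?thesis .
    qed
    then have "(3 * (\<delta> - u) + \<delta>) / \<delta> ^ 4 \<le> 8" using assms by (simp add: divide_le_eq)
    moreover have "1 / \<delta> ^ 3 = \<delta> / \<delta> ^ 4" using assms by (simp add: field_simps eval_nat_numeral)
    moreover have "(3 * (\<delta> - u) + \<delta>) / \<delta> ^ 4 = 3 * (\<delta> - u) / \<delta> ^ 4 + \<delta> / \<delta> ^ 4"
      by (rule add_divide_distrib)
    ultimately show ?thesis using False unfolding trunc_inv_cube_def by auto
  qed
  then show ?thesis using excess_nonneg[OF assms, of u] by simp
next
  case False
  have "(trunc_inv_cube \<delta> u - 1) * (1/2) \<le> (trunc_inv_cube \<delta> u - 1) * (1 - u)"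
    using trunc_inv_cube_ge_tangent[of \<delta> u] False assms by (intro mult_left_mono) auto
  also have "\<dots> = excess \<delta> u" by (simp add: excess_def algebra_simps)
  finally show ?thesis by simp
qed

text \<open>The pointwise form of coercivity. Here \<open>1 + \<sigma>\<close> and \<open>1 + \<gamma>\<close> are the rescaled residual and
value of the comparison function. The two factors vanish at different points, and between these the product
is negative; but there \<open>u - 1\<close> is at most of the order of \<open>\<sigma>\<close> and \<open>\<gamma>\<close>, or else \<open>\<sigma>\<close> is bounded
away from \<open>0\<close>, and a quadratic error suffices. The bound \<open>1 + \<sigma> \<ge> 1/2\<close> keeps the product
positive for large \<open>u\<close>, where the nonlinearity is negligible.\<close>

lemma energy_density_ge:
  assumes "0 < \<delta>" "\<delta> \<le> 1" "1 + \<sigma> \<ge> 1/2" "\<gamma> \<ge> 0"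
  shows "(1 + \<sigma> - trunc_inv_cube \<delta> u) * (u - 1 - \<gamma>) \<ge> excess \<delta> u / 8 - 200 * (\<sigma>\<^sup>2 + \<gamma>\<^sup>2)"
proof (cases "u \<ge> 1")
  case True
  define \<kappa> f where "\<kappa> = 1 - trunc_inv_cube \<delta> u" and "f = u - 1"
  note k = trunc_inv_cube_ge_1[OF assms(2) True]
  have \<kappa>: "0 \<le> \<kappa>" "\<kappa> \<le> 1" "\<kappa> \<le> 3 * f" and f: "f \<ge> 0"
    using k True by (auto simp: \<kappa>_def f_def)
  have j: "excess \<delta> u = \<kappa> * f" by (simp add: excess_def \<kappa>_def f_def)
  have i: "(1 + \<sigma> - trunc_inv_cube \<delta> u) * (u - 1 - \<gamma>) = (\<kappa> + \<sigma>) * (f - \<gamma>)"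
    by (simp add: \<kappa>_def f_def)
  have sq: "\<bar>\<sigma>\<bar> * \<bar>\<sigma>\<bar> = \<sigma>\<^sup>2" "\<sigma>\<^sup>2 \<ge> 0" "\<gamma>\<^sup>2 \<ge> 0" by (auto simp: power2_eq_square)
  have sg: "\<bar>\<sigma>\<bar> * \<gamma> \<le> \<sigma>\<^sup>2 + \<gamma>\<^sup>2"
  proof -
    have "2 * (\<bar>\<sigma>\<bar> * \<gamma>) \<le> \<sigma>\<^sup>2 + \<gamma>\<^sup>2" using sum_squares_bound[of "\<bar>\<sigma>\<bar>" \<gamma>] by simp
    moreover have "0 \<le> \<bar>\<sigma>\<bar> * \<gamma>" using assms by simp
    ultimately show ?thesis by linarith
  qed

  define t where "t = \<bar>\<sigma>\<bar>"
  define P where "P = (\<kappa> + \<sigma>) * (f - \<gamma>)"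
  \<comment> \<open>in \<open>good\<close> and \<open>far\<close> the product itself is large; otherwise \<open>f\<close> is bounded by a
    multiple of \<open>\<gamma>\<close> or of \<open>\<bar>\<sigma>\<bar>\<close>\<close>
  consider (small_f) "f < 2 * \<gamma>" | (good) "f \<ge> 2 * \<gamma>" "\<kappa> \<ge> - 2 * \<sigma>"
    | (small_\<sigma>) "f \<ge> 2 * \<gamma>" "\<kappa> < - 2 * \<sigma>" "\<bar>\<sigma>\<bar> \<le> 1/4"
    | (far) "f \<ge> 2 * \<gamma>" "\<kappa> < - 2 * \<sigma>" "\<bar>\<sigma>\<bar> > 1/4" "trunc_inv_cube \<delta> u \<le> 1/4"
    | (mid) "f \<ge> 2 * \<gamma>" "\<kappa> < - 2 * \<sigma>" "\<bar>\<sigma>\<bar> > 1/4" "trunc_inv_cube \<delta> u > 1/4"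
    by linarith
  then have "P \<ge> \<kappa> * f / 8 - 200 * (\<sigma>\<^sup>2 + \<gamma>\<^sup>2)"
  proof cases
    case small_f
    have "\<bar>P\<bar> \<le> (6 * \<gamma> + t) * \<gamma>"
      unfolding P_def abs_mult t_def using small_f \<kappa> f by (intro mult_mono) auto
    also have "\<dots> = 6 * \<gamma>\<^sup>2 + t * \<gamma>" by (simp add: power2_eq_square algebra_simps)
    also have "\<dots> \<le> 6 * \<gamma>\<^sup>2 + (\<sigma>\<^sup>2 + \<gamma>\<^sup>2)" using sg by (simp add: t_def)
    finally have "\<bar>P\<bar> \<le> 6 * \<gamma>\<^sup>2 + (\<sigma>\<^sup>2 + \<gamma>\<^sup>2)" .
    moreover have "\<kappa> * f \<le> (6 * \<gamma>) * (2 * \<gamma>)"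
      using small_f \<kappa> f by (intro mult_mono) auto
    then have "\<kappa> * f \<le> 12 * \<gamma>\<^sup>2" by (simp add: power2_eq_square)
    ultimately show ?thesis using sq(2,3) by argo
  next
    case good
    have "\<kappa> / 2 * (f / 2) \<le> P"
      unfolding P_def using good \<kappa> f by (intro mult_mono) auto
    then have "\<kappa> * f / 4 \<le> P" by simp
    moreover have "\<kappa> * f \<ge> 0" using \<kappa> f by simp
    ultimately show ?thesis using sq(2,3) by argo
  next
    case small_\<sigma>
    have "trunc_inv_cube \<delta> u > 1/2" using small_\<sigma> by (simp add: \<kappa>_def)
    then have "u ^ 3 < 2" using k(1) True by (simp add: field_simps)
    moreover have "u \<le> u ^ 3" using True by (simp add: self_le_power)
    ultimately have "u < 2" by simp
    have "f / 2 \<le> f / u" using f True \<open>u < 2\<close> by (intro divide_left_mono) auto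
    also have "\<dots> \<le> \<kappa>" using k(4) by (simp add: f_def \<kappa>_def)
    finally have f4: "f \<le> 4 * t" "\<kappa> \<le> 2 * t" using small_\<sigma> by (auto simp: t_def)
    have "\<bar>P\<bar> \<le> (3 * t) * (4 * t)"
      unfolding P_def abs_mult using small_\<sigma> f4 f \<kappa> assms t_def by (intro mult_mono) auto
    then have "\<bar>P\<bar> \<le> 12 * \<sigma>\<^sup>2" by (simp add: t_def power2_eq_square)
    moreover have "\<kappa> * f \<le> (2 * t) * (4 * t)" using f4 f \<kappa> by (intro mult_mono) auto
    then have "\<kappa> * f \<le> 8 * \<sigma>\<^sup>2" by (simp add: t_def power2_eq_square)
    ultimately show ?thesis using sq(2,3) by argo
  next
    case far
    have "1/4 * (f / 2) \<le> P"
      unfolding P_def using far \<kappa> f assms by (intro mult_mono) (auto simp: \<kappa>_def)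
    moreover have "\<kappa> * f \<le> 1 * f" using \<kappa> f by (intro mult_right_mono) auto
    ultimately show ?thesis using sq(2,3) by argo
  next
    case mid
    then have "u ^ 3 < 4" using k(1) True by (simp add: field_simps)
    moreover have "u \<le> u ^ 3" using True by (simp add: self_le_power)
    ultimately have f4: "f \<le> 16 * t" using mid by (simp add: f_def t_def)
    have "\<bar>P\<bar> \<le> (5 * t) * (16 * t)"
      unfolding P_def abs_mult using mid f4 f \<kappa> assms t_def by (intro mult_mono) auto
    then have "\<bar>P\<bar> \<le> 80 * \<sigma>\<^sup>2" by (simp add: t_def power2_eq_square)
    moreover have "\<kappa> * f \<le> (4 * t) * (16 * t)"
      using mid f4 f \<kappa> t_def by (intro mult_mono) auto
    then have "\<kappa> * f \<le> 64 * \<sigma>\<^sup>2" by (simp add: t_def power2_eq_square)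
    ultimately show ?thesis using sq(2,3) by argo
  qed
  then show ?thesis by (simp only: i j P_def)
next
  case False
  define k f where "k = trunc_inv_cube \<delta> u - 1" and "f = 1 - u"
  have f: "f > 0" "k \<ge> 3 * f"
    using False trunc_inv_cube_ge_tangent[of \<delta> u] assms by (auto simp: k_def f_def)
  have j: "excess \<delta> u = k * f" by (simp add: excess_def k_def f_def algebra_simps)
  have i: "(1 + \<sigma> - trunc_inv_cube \<delta> u) * (u - 1 - \<gamma>) = (k - \<sigma>) * (f + \<gamma>)"
    by (simp add: k_def f_def algebra_simps)
  have sq: "\<sigma>\<^sup>2 \<ge> 0" "\<gamma>\<^sup>2 \<ge> 0" by auto
  have "(k - \<sigma>) * (f + \<gamma>) \<ge> k * f / 8 - 200 * (\<sigma>\<^sup>2 + \<gamma>\<^sup>2)"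
  proof (cases "k \<ge> 2 * \<sigma>")
    case True
    have "k / 2 * f \<le> (k - \<sigma>) * (f + \<gamma>)" using True f assms by (intro mult_mono) auto
    moreover have "k / 2 * f = k * f / 2" "k * f \<ge> 0" using f by simp_all
    ultimately show ?thesis using sq by argo
  next
    case False
    then have \<sigma>: "\<sigma> > 0" "f \<le> \<sigma>" "k \<le> 2 * \<sigma>" using f by auto
    have "(\<sigma> - k) * (f + \<gamma>) \<le> \<sigma> * (\<sigma> + \<gamma>)" using \<sigma> f assms by (intro mult_mono) auto
    moreover have "k * f \<le> (2 * \<sigma>) * \<sigma>" using \<sigma> f by (intro mult_mono) auto
    moreover have "2 * (\<sigma> * \<gamma>) \<le> \<sigma>\<^sup>2 + \<gamma>\<^sup>2" using sum_squares_bound[of \<sigma> \<gamma>] by simp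
    moreover have "(\<sigma> - k) * (f + \<gamma>) = - ((k - \<sigma>) * (f + \<gamma>))" "\<sigma> * (\<sigma> + \<gamma>) = \<sigma>\<^sup>2 + \<sigma> * \<gamma>"
      "(2 * \<sigma>) * \<sigma> = 2 * \<sigma>\<^sup>2" by (auto simp: power2_eq_square algebra_simps)
    ultimately show ?thesis using sq by argo
  qed
  then show ?thesis by (simp only: i j)
qed


section \<open>The far-field profile and a positive reference profile\<close>

text \<open>The exponents of the problem are multiples of \<open>1/9\<close>, and the decay rate obtained below is a
further fourth root; with the 36th root as unit all weights are integer powers.\<close>

definition scl :: "real \<Rightarrow> real" where
  "scl x = (1 + x\<^sup>2) powr (1/36)"

text \<open>The state \<open>\<Phi> = 1\<close> in the original variable, followed by its first three derivatives.\<close>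

definition far :: "real \<Rightarrow> real" where
  "far x = (1 + x\<^sup>2) powr (-1/3)"

definition far1 :: "real \<Rightarrow> real" where
  "far1 x = - (2/3) * x * (1 + x\<^sup>2) powr (-4/3)"

definition far2 :: "real \<Rightarrow> real" where
  "far2 x = - (2/3) * (1 + x\<^sup>2) powr (-4/3) + 16/9 * x\<^sup>2 * (1 + x\<^sup>2) powr (-7/3)"

definition far3 :: "real \<Rightarrow> real" where
  "far3 x = 16/3 * x * (1 + x\<^sup>2) powr (-7/3) - 224/27 * x ^ 3 * (1 + x\<^sup>2) powr (-10/3)"

lemma one_plus_sq_ge_1: "1 \<le> 1 + (x::real)\<^sup>2" and one_plus_sq_pos: "0 < 1 + (x::real)\<^sup>2"
  by (auto intro: add_pos_nonneg)

lemma one_plus_sq_powr_deriv: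
  "((\<lambda>x. (1 + x\<^sup>2) powr c) has_real_derivative 2 * c * x * (1 + x\<^sup>2) powr (c - 1)) (at x)"
  using one_plus_sq_pos[of x]
  by (auto intro!: derivative_eq_intros)

lemma far_deriv: "(far has_real_derivative far1 x) (at x)"
  unfolding far_def[abs_def] far1_def
  by (rule DERIV_cong[OF one_plus_sq_powr_deriv]) simp

lemma far1_deriv: "(far1 has_real_derivative far2 x) (at x)"
  unfolding far1_def[abs_def] far2_def
  by (rule one_plus_sq_powr_deriv derivative_eq_intros refl | simp add: power2_eq_square)+

lemma far2_deriv: "(far2 has_real_derivative far3 x) (at x)"
  unfolding far2_def[abs_def] far3_def
  by (rule one_plus_sq_powr_deriv derivative_eq_intros refl
      | simp add: power2_eq_square power3_eq_cube algebra_simps)+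

lemma scl_ge_1: "1 \<le> scl x"
  unfolding scl_def using one_plus_sq_ge_1 by (simp add: ge_one_powr_ge_zero)

lemma scl_pos: "0 < scl x"
  using scl_ge_1[of x] by simp

lemma scl_power: "scl x ^ n = (1 + x\<^sup>2) powr (real n / 36)"
  using one_plus_sq_pos[of x] by (simp add: scl_def powr_power)

lemma scl_power_36: "scl x ^ 36 = 1 + x\<^sup>2"
  using one_plus_sq_pos[of x] by (simp add: scl_power)

lemma far_eq: "far x = 1 / scl x ^ 12"
  by (simp add: far_def scl_power powr_minus_divide)

lemma far3_bound: "\<bar>far3 x\<bar> \<le> 14"
proof -
  let ?q = "1 + x\<^sup>2"
  have x: "\<bar>x\<bar> \<le> ?q" using sum_squares_bound[of 1 "\<bar>x\<bar>"] by (simp add: power2_eq_square)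
  have 1: "\<bar>x\<bar> * ?q powr (-7/3) \<le> 1"
  proof -
    have "\<bar>x\<bar> * ?q powr (-7/3) \<le> ?q * ?q powr (-1)"
      using x one_plus_sq_ge_1[of x] by (intro mult_mono powr_mono) auto
    also have "\<dots> = 1" using one_plus_sq_pos[of x] by (simp add: powr_minus_divide)
    finally show ?thesis .
  qed
  have 2: "\<bar>x\<bar> ^ 3 * ?q powr (-10/3) \<le> 1"
  proof -
    have "\<bar>x\<bar> ^ 3 * ?q powr (-10/3) \<le> ?q ^ 3 * ?q powr (-3)"
      using x one_plus_sq_ge_1[of x] by (intro mult_mono powr_mono power_mono) auto
    also have "\<dots> = 1" using one_plus_sq_pos[of x] by (simp add: powr_minus_divide)
    finally show ?thesis .
  qed
  have "\<bar>far3 x\<bar> \<le> \<bar>16/3 * x * ?q powr (-7/3)\<bar> + \<bar>224/27 * x ^ 3 * ?q powr (-10/3)\<bar>"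
    unfolding far3_def by (rule abs_triangle_ineq4)
  also have "\<dots> = 16/3 * (\<bar>x\<bar> * ?q powr (-7/3)) + 224/27 * (\<bar>x\<bar> ^ 3 * ?q powr (-10/3))"
    by (simp add: abs_mult power_abs)
  finally show ?thesis using 1 2 by argo
qed

text \<open>The third derivative of \<open>1 / (1 + s^2)^2\<close> is positive around \<open>s = 1/2\<close>; where it is not, the
parabola centred there is large. The sum is therefore uniformly positive.\<close>

lemma bump_third_derivative_bounds:
  fixes s :: real
  defines "d \<equiv> (72 * s - 120 * s ^ 3) / (1 + s\<^sup>2) ^ 5"
  shows "\<bar>d\<bar> \<le> 120" "d / 7680 + (s - 1/2)\<^sup>2 / 2 \<ge> 1 / 100000"
proof -
  have s: "\<bar>s\<bar> \<le> 1 + s\<^sup>2" using sum_squares_bound[of 1 "\<bar>s\<bar>"] by (simp add: power2_eq_square)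
  have "\<bar>72 * s - 120 * s ^ 3\<bar> = \<bar>s\<bar> * \<bar>72 - 120 * s\<^sup>2\<bar>"
    by (simp add: abs_mult[symmetric] algebra_simps power2_eq_square power3_eq_cube)
  also have "\<dots> \<le> (1 + s\<^sup>2) * (120 * (1 + s\<^sup>2))"
    using s by (intro mult_mono) (auto simp: abs_le_iff)
  also have "\<dots> = 120 * (1 + s\<^sup>2) ^ 2" by (simp add: power2_eq_square)
  also have "\<dots> \<le> 120 * (1 + s\<^sup>2) ^ 5"
    by (intro mult_left_mono power_increasing) auto
  finally show d120: "\<bar>d\<bar> \<le> 120"
    unfolding d_def using one_plus_sq_pos[of s] by (simp add: abs_divide divide_le_eq)
  show "d / 7680 + (s - 1/2)\<^sup>2 / 2 \<ge> 1 / 100000"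
  proof (cases "\<bar>s - 1/2\<bar> \<le> 1/4")
    case True
    then have s: "1/4 \<le> s" "s \<le> 3/4" unfolding abs_le_iff by linarith+
    have "s\<^sup>2 \<le> (3/4)\<^sup>2" using s by (intro power_mono) auto
    then have s2: "s\<^sup>2 \<le> 9/16" by (simp add: power_divide)
    have "9/8 = 1/4 * (72 - 120 * (9/16::real))" by simp
    also have "\<dots> \<le> s * (72 - 120 * s\<^sup>2)"
      using s s2 by (intro mult_mono) auto
    also have "\<dots> = 72 * s - 120 * s ^ 3" by (simp add: algebra_simps power2_eq_square power3_eq_cube)
    finally have n: "9/8 \<le> 72 * s - 120 * s ^ 3" .
    have "(1 + s\<^sup>2) ^ 5 \<le> (25/16) ^ 5" using s2 by (intro power_mono) auto
    also have "\<dots> \<le> 10" by (simp add: power_divide)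
    finally have "(9/8) / 10 \<le> d"
      unfolding d_def using n one_plus_sq_pos[of s] by (intro frac_le) auto
    moreover have "(s - 1/2)\<^sup>2 \<ge> 0" by simp
    ultimately show ?thesis by argo
  next
    case False
    then have "(1/4)\<^sup>2 \<le> \<bar>s - 1/2\<bar>\<^sup>2" by (intro power_mono) auto
    then have "1/16 \<le> (s - 1/2)\<^sup>2" by (simp add: power_divide)
    then show ?thesis using d120 by argo
  qed
qed

lemma bump_derivs:
  fixes s :: real
  shows "((\<lambda>s. 1 / (1 + s\<^sup>2) ^ 2) has_real_derivative - 4 * s / (1 + s\<^sup>2) ^ 3) (at s)"
    and "((\<lambda>s. - 4 * s / (1 + s\<^sup>2) ^ 3) has_real_derivative (20 * s\<^sup>2 - 4) / (1 + s\<^sup>2) ^ 4) (at s)"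
    and "((\<lambda>s. (20 * s\<^sup>2 - 4) / (1 + s\<^sup>2) ^ 4) has_real_derivative
           (72 * s - 120 * s ^ 3) / (1 + s\<^sup>2) ^ 5) (at s)"
proof -
  have nz: "1 + s\<^sup>2 \<noteq> 0" using one_plus_sq_pos[of s] by simp
  have gd: "((\<lambda>s. (1 + s\<^sup>2) ^ n) has_real_derivative real n * (1 + s\<^sup>2) ^ (n - 1) * (2 * s)) (at s)" for n
    by (rule derivative_eq_intros refl | simp)+
  have nd: "((\<lambda>s. 20 * s\<^sup>2 - 4) has_real_derivative 40 * s) (at s)"
    by (rule derivative_eq_intros refl | simp)+
  define r where "r = 1 + s\<^sup>2"
  have r: "r \<noteq> 0" using nz by (simp add: r_def)
  have "((\<lambda>s. 1 / (1 + s\<^sup>2) ^ 2) has_real_derivative - (2 * r * (2 * s)) / (r\<^sup>2 * r\<^sup>2)) (at s)"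
    unfolding r_def by (rule DERIV_cong[OF DERIV_divide[OF DERIV_const gd[of 2]]]) (use nz in auto)
  also have "- (2 * r * (2 * s)) / (r\<^sup>2 * r\<^sup>2) = - 4 * s / r ^ 3"
    using r by (simp add: field_simps eval_nat_numeral)
  finally show "((\<lambda>s. 1 / (1 + s\<^sup>2) ^ 2) has_real_derivative - 4 * s / (1 + s\<^sup>2) ^ 3) (at s)"
    by (simp add: r_def)
  have "((\<lambda>s. - 4 * s / (1 + s\<^sup>2) ^ 3) has_real_derivative
       (- 4 * r ^ 3 - (- 4 * s) * (3 * r\<^sup>2 * (2 * s))) / (r ^ 3 * r ^ 3)) (at s)"
    unfolding r_def by (rule DERIV_cong[OF DERIV_divide[OF DERIV_cmult[OF DERIV_ident] gd[of 3]]]) (use nz in auto)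
  also have "(- 4 * r ^ 3 - (- 4 * s) * (3 * r\<^sup>2 * (2 * s))) / (r ^ 3 * r ^ 3) = (20 * s\<^sup>2 - 4) / r ^ 4"
  proof -
    have "- 4 * r ^ 3 - (- 4 * s) * (3 * r\<^sup>2 * (2 * s)) = r\<^sup>2 * (20 * s\<^sup>2 - 4)"
      unfolding r_def by (simp add: algebra_simps eval_nat_numeral)
    moreover have "r ^ 3 * r ^ 3 = r\<^sup>2 * r ^ 4" by (simp flip: power_add)
    ultimately show ?thesis using r by (simp only: mult_divide_mult_cancel_left power_eq_0_iff simp_thms)
  qed
  finally show "((\<lambda>s. - 4 * s / (1 + s\<^sup>2) ^ 3) has_real_derivative (20 * s\<^sup>2 - 4) / (1 + s\<^sup>2) ^ 4) (at s)"
    by (simp add: r_def)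
  have "((\<lambda>s. (20 * s\<^sup>2 - 4) / (1 + s\<^sup>2) ^ 4) has_real_derivative
       (40 * s * r ^ 4 - (20 * s\<^sup>2 - 4) * (4 * r ^ 3 * (2 * s))) / (r ^ 4 * r ^ 4)) (at s)"
    unfolding r_def by (rule DERIV_cong[OF DERIV_divide[OF nd gd[of 4]]]) (use nz in auto)
  also have "(40 * s * r ^ 4 - (20 * s\<^sup>2 - 4) * (4 * r ^ 3 * (2 * s))) / (r ^ 4 * r ^ 4)
     = (72 * s - 120 * s ^ 3) / r ^ 5"
  proof -
    have "40 * s * r ^ 4 - (20 * s\<^sup>2 - 4) * (4 * r ^ 3 * (2 * s))
        = r ^ 3 * (40 * s * r - (20 * s\<^sup>2 - 4) * (4 * (2 * s)))"
      by (simp add: algebra_simps eval_nat_numeral)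
    also have "40 * s * r - (20 * s\<^sup>2 - 4) * (4 * (2 * s)) = 72 * s - 120 * s ^ 3"
      unfolding r_def by (simp add: algebra_simps eval_nat_numeral)
    finally have "40 * s * r ^ 4 - (20 * s\<^sup>2 - 4) * (4 * r ^ 3 * (2 * s))
        = r ^ 3 * (72 * s - 120 * s ^ 3)" .
    moreover have "r ^ 4 * r ^ 4 = r ^ 3 * r ^ 5" by (simp flip: power_add)
    ultimately show ?thesis using r by (simp only: mult_divide_mult_cancel_left power_eq_0_iff simp_thms)
  qed
  finally show "((\<lambda>s. (20 * s\<^sup>2 - 4) / (1 + s\<^sup>2) ^ 4) has_real_derivative
           (72 * s - 120 * s ^ 3) / (1 + s\<^sup>2) ^ 5) (at s)"
    by (simp add: r_def)
qed

text \<open>For very negative \<open>a\<close> the far-field profile is no admissible comparison function, as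
\<open>a + x^2\<close> is negative near the origin. Adding a bump of width \<open>m\<close> and height of order \<open>m^5\<close>, placed so that
the origin corresponds to \<open>s = 1/2\<close>, raises the third derivative near the origin by an amount of order
\<open>m^2\<close> and lowers it elsewhere by less than half of \<open>x^2\<close>. The bump is positive and decays like
\<open>x^(-4)\<close>, fast enough for the squares of \<open>\<sigma>\<close> and \<open>\<gamma>\<close> to be integrable in the weight of the energy.\<close>

lemma reference_profile:
  fixes a :: real
  obtains G G1 G2 G3 :: "real \<Rightarrow> real" and \<sigma> \<gamma> :: "real \<Rightarrow> real" and C :: real where
    "\<And>x. (G has_real_derivative G1 x) (at x)"
    "\<And>x. (G1 has_real_derivative G2 x) (at x)"
    "\<And>x. (G2 has_real_derivative G3 x) (at x)"
    "\<And>x. G x = (1 + \<gamma> x) / scl x ^ 12"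
    "\<And>x. a + x\<^sup>2 + G3 x = (1 + \<sigma> x) * scl x ^ 36"
    "\<And>x. 1 + \<sigma> x \<ge> 1/2" "\<And>x. \<gamma> x \<ge> 0"
    "\<And>x. scl x ^ 60 * ((\<sigma> x)\<^sup>2 + (\<gamma> x)\<^sup>2) \<le> C" "C > 0"
proof -
  define m where "m = 100000 * (\<bar>a\<bar> + 15)"
  have m1: "m \<ge> 1" by (simp add: m_def)
  have "m * 1 \<le> m * m" using m1 by (intro mult_left_mono) auto
  then have mm: "m\<^sup>2 / 100000 \<ge> \<bar>a\<bar> + 15" by (simp add: m_def power2_eq_square)
  define S where "S x = x / m + 1/2" for x
  have Sd: "(S has_real_derivative 1 / m) (at x)" for x
    unfolding S_def using m1 by (auto intro!: derivative_eq_intros)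
  define b0 b1 b2 b3 where "b0 s = 1 / (1 + s\<^sup>2) ^ 2" and "b1 s = - 4 * s / (1 + s\<^sup>2) ^ 3"
    and "b2 s = (20 * s\<^sup>2 - 4) / (1 + s\<^sup>2) ^ 4" and "b3 s = (72 * s - 120 * s ^ 3) / (1 + s\<^sup>2) ^ 5"
    for s :: real
  have chain: "((\<lambda>x. m ^ Suc n / 7680 * f (S x)) has_real_derivative m ^ n / 7680 * f' (S x)) (at x)"
    if "\<And>s. (f has_real_derivative f' s) (at s)" for f f' :: "real \<Rightarrow> real" and n x
    by (rule DERIV_cong[OF DERIV_cmult[OF DERIV_chain2[OF that Sd]]]) (use m1 in simp)
  have b: "(b0 has_real_derivative b1 s) (at s)" "(b1 has_real_derivative b2 s) (at s)"
    "(b2 has_real_derivative b3 s) (at s)" for s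
    unfolding b0_def b1_def b2_def b3_def by (rule bump_derivs)+
  define G where "G x = far x + m ^ 5 / 7680 * b0 (S x)" for x
  define G1 where "G1 x = far1 x + m ^ 4 / 7680 * b1 (S x)" for x
  define G2 where "G2 x = far2 x + m ^ 3 / 7680 * b2 (S x)" for x
  define G3 where "G3 x = far3 x + m ^ 2 / 7680 * b3 (S x)" for x
  define \<gamma> where "\<gamma> x = scl x ^ 12 * (m ^ 5 / 7680 * b0 (S x))" for x
  define \<sigma> where "\<sigma> x = (a - 1 + G3 x) / scl x ^ 36" for x
  define CB where "CB = m ^ 5 / 7680 * (1 + 2 * m\<^sup>2)\<^sup>2"
  define CS where "CS = \<bar>a\<bar> + 15 + m\<^sup>2"
  have G3b: "\<bar>G3 x\<bar> \<le> 14 + m\<^sup>2" for x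
  proof -
    have "\<bar>m\<^sup>2 / 7680 * b3 (S x)\<bar> \<le> m\<^sup>2 / 7680 * 120"
      unfolding abs_mult b3_def using bump_third_derivative_bounds(1)[of "S x"]
      by (intro mult_mono) auto
    moreover have "m\<^sup>2 \<ge> 0" by simp
    ultimately show ?thesis unfolding G3_def using far3_bound[of x] by argo
  qed
  have "\<bar>\<sigma> x\<bar> \<le> CS / scl x ^ 36" for x
    unfolding \<sigma>_def CS_def abs_divide using G3b[of x] scl_pos[of x]
    by (auto intro!: divide_right_mono)
  then have \<sigma>b: "scl x ^ 60 * (\<sigma> x)\<^sup>2 \<le> CS\<^sup>2" for x
  proof -
    have "scl x ^ 30 * \<bar>\<sigma> x\<bar> \<le> scl x ^ 36 * \<bar>\<sigma> x\<bar>"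
      using scl_ge_1[of x] by (intro mult_right_mono power_increasing) auto
    also have "\<dots> \<le> CS" using \<open>\<bar>\<sigma> x\<bar> \<le> CS / scl x ^ 36\<close> scl_pos[of x] by (simp add: field_simps)
    finally have "(scl x ^ 30 * \<bar>\<sigma> x\<bar>)\<^sup>2 \<le> CS\<^sup>2"
      using scl_pos[of x] by (intro power_mono) auto
    then show ?thesis by (simp add: power_mult_distrib flip: power_mult)
  qed
  have \<gamma>0: "\<gamma> x \<ge> 0" for x
    unfolding \<gamma>_def b0_def using m1 scl_pos[of x] by simp
  have b0b: "b0 (S x) * (scl x ^ 36)\<^sup>2 \<le> (1 + 2 * m\<^sup>2)\<^sup>2" for x
  proof -
    have x: "x = m * (S x - 1/2)" using m1 by (simp add: S_def)
    have "x\<^sup>2 = m\<^sup>2 * (S x - 1/2)\<^sup>2" by (subst x) (simp only: power_mult_distrib)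
    also have "\<dots> \<le> m\<^sup>2 * (2 * (1 + (S x)\<^sup>2))"
    proof (rule mult_left_mono)
      have "0 \<le> (S x + 1/2)\<^sup>2" by simp
      then show "(S x - 1/2)\<^sup>2 \<le> 2 * (1 + (S x)\<^sup>2)"
        by (simp add: power2_eq_square algebra_simps)
    qed simp
    finally have "x\<^sup>2 \<le> m\<^sup>2 * (2 * (1 + (S x)\<^sup>2))" .
    moreover have "(1 + 2 * m\<^sup>2) * (1 + (S x)\<^sup>2) = 1 + (S x)\<^sup>2 + m\<^sup>2 * (2 * (1 + (S x)\<^sup>2))"
      by (simp add: algebra_simps)
    ultimately have "1 + x\<^sup>2 \<le> (1 + 2 * m\<^sup>2) * (1 + (S x)\<^sup>2)"
      using zero_le_power2[of "S x"] by linarith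
    then have "(scl x ^ 36)\<^sup>2 \<le> ((1 + 2 * m\<^sup>2) * (1 + (S x)\<^sup>2))\<^sup>2"
      unfolding scl_power_36 by (intro power_mono) auto
    then show ?thesis
      using one_plus_sq_pos[of "S x"] by (simp add: b0_def divide_le_eq power_mult_distrib)
  qed
  have \<gamma>b: "scl x ^ 60 * (\<gamma> x)\<^sup>2 \<le> CB\<^sup>2" for x
  proof -
    have "scl x ^ 30 * \<gamma> x \<le> scl x ^ 60 * \<gamma> x"
      using scl_ge_1[of x] \<gamma>0 by (intro mult_right_mono power_increasing) auto
    also have "\<dots> = m ^ 5 / 7680 * (b0 (S x) * (scl x ^ 36)\<^sup>2)"
      by (simp add: \<gamma>_def flip: power_mult power_add)
    also have "\<dots> \<le> CB" unfolding CB_def using b0b m1 by (intro mult_left_mono) auto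
    finally have "(scl x ^ 30 * \<gamma> x)\<^sup>2 \<le> CB\<^sup>2"
      using scl_pos[of x] \<gamma>0 by (intro power_mono) auto
    then show ?thesis by (simp add: power_mult_distrib flip: power_mult)
  qed
  show thesis
  proof (rule that[of G G1 G2 G3 \<gamma> \<sigma> "CS\<^sup>2 + CB\<^sup>2"])
    show "(G has_real_derivative G1 x) (at x)" for x
      unfolding G_def G1_def
      using DERIV_add[OF far_deriv chain[OF b(1), of 4]] by simp
    show "(G1 has_real_derivative G2 x) (at x)" for x
      unfolding G1_def G2_def
      using DERIV_add[OF far1_deriv chain[OF b(2), of 3]] by simp
    show "(G2 has_real_derivative G3 x) (at x)" for x
      unfolding G2_def G3_def
      using DERIV_add[OF far2_deriv chain[OF b(3), of 2]] by simp
    show "G x = (1 + \<gamma> x) / scl x ^ 12" for x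
      using scl_pos[of x] by (simp add: G_def \<gamma>_def far_eq field_simps)
    show \<rho>: "a + x\<^sup>2 + G3 x = (1 + \<sigma> x) * scl x ^ 36" for x
    proof -
      have "(1 + \<sigma> x) * scl x ^ 36 = scl x ^ 36 + (a - 1 + G3 x)"
        using scl_pos[of x] by (simp only: \<sigma>_def distrib_right mult_1_left) simp
      then show ?thesis by (simp add: scl_power_36)
    qed
    show "\<gamma> x \<ge> 0" for x by (rule \<gamma>0)
    show "scl x ^ 60 * ((\<sigma> x)\<^sup>2 + (\<gamma> x)\<^sup>2) \<le> CS\<^sup>2 + CB\<^sup>2" for x
      using \<sigma>b[of x] \<gamma>b[of x] by (simp add: distrib_left)
    have "CS > 0" unfolding CS_def using zero_le_power2[of m] by linarith
    then show "CS\<^sup>2 + CB\<^sup>2 > 0" by (intro add_pos_nonneg) auto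
    show "1 + \<sigma> x \<ge> 1/2" for x
    proof -
      have "x\<^sup>2 = (m * (S x - 1/2))\<^sup>2" using m1 by (simp add: S_def)
      then have "x\<^sup>2 = m\<^sup>2 * (S x - 1/2)\<^sup>2" by (simp only: power_mult_distrib)
      moreover have "m\<^sup>2 * (b3 (S x) / 7680 + (S x - 1/2)\<^sup>2 / 2) \<ge> m\<^sup>2 * (1 / 100000)"
        unfolding b3_def by (intro mult_left_mono bump_third_derivative_bounds) auto
      moreover have "m\<^sup>2 * (b3 (S x) / 7680 + (S x - 1/2)\<^sup>2 / 2)
          = m\<^sup>2 / 7680 * b3 (S x) + m\<^sup>2 * (S x - 1/2)\<^sup>2 / 2" by (simp add: algebra_simps)
      ultimately have "m\<^sup>2 / 7680 * b3 (S x) + x\<^sup>2 / 2 \<ge> m\<^sup>2 / 100000" by argo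
      then have "a + x\<^sup>2 + G3 x \<ge> 1/2 * (1 + x\<^sup>2)"
        unfolding G3_def using mm far3_bound[of x] by argo
      then have "1/2 * scl x ^ 36 \<le> (1 + \<sigma> x) * scl x ^ 36" by (simp only: \<rho> scl_power_36)
      then show ?thesis using scl_pos[of x] by (simp only: mult_le_cancel_right_pos zero_less_power)
    qed
  qed
qed


section \<open>The truncated third-order equation and its boundary value problem\<close>

text \<open>In the rescaled variable \<open>scl x ^ 12 * u\<close> truncation happens at a fixed level. Above that level the
right-hand side is \<open>1 / u^3 - (a + x^2)\<close>, since \<open>scl x ^ 36\<close> cancels the rescaling.\<close>

definition third_rhs :: "real \<Rightarrow> real \<Rightarrow> real \<Rightarrow> real \<Rightarrow> real" where
  "third_rhs \<delta> a x u = scl x ^ 36 * trunc_inv_cube \<delta> (scl x ^ 12 * u) - (a + x\<^sup>2)"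

definition trunc_field :: "real \<Rightarrow> real \<Rightarrow> real \<Rightarrow> real \<times> real \<times> real \<Rightarrow> real \<times> real \<times> real" where
  "trunc_field \<delta> a x = (\<lambda>(u, v, w). (v, w, third_rhs \<delta> a x u))"

definition trunc_solution :: "real \<Rightarrow> real \<Rightarrow> (real \<Rightarrow> real \<times> real \<times> real) \<Rightarrow> bool" where
  "trunc_solution \<delta> a X \<longleftrightarrow> (\<forall>x. (X has_vector_derivative trunc_field \<delta> a x (X x)) (at x))"

lemma trunc_solution_derivs:
  assumes "trunc_solution \<delta> a X"
  shows "((\<lambda>x. fst (X x)) has_real_derivative fst (snd (X x))) (at x)"
    and "((\<lambda>x. fst (snd (X x))) has_real_derivative snd (snd (X x))) (at x)"
    and "((\<lambda>x. snd (snd (X x))) has_real_derivative third_rhs \<delta> a x (fst (X x))) (at x)"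
proof -
  have X: "(X has_vector_derivative trunc_field \<delta> a x (X x)) (at x)"
    using assms by (simp add: trunc_solution_def)
  note f = bounded_linear.has_vector_derivative[OF bounded_linear_fst]
    and s = bounded_linear.has_vector_derivative[OF bounded_linear_snd]
  note F = f[OF X] f[OF s[OF X]] s[OF s[OF X]]
  show "((\<lambda>x. fst (X x)) has_real_derivative fst (snd (X x))) (at x)"
    "((\<lambda>x. fst (snd (X x))) has_real_derivative snd (snd (X x))) (at x)"
    "((\<lambda>x. snd (snd (X x))) has_real_derivative third_rhs \<delta> a x (fst (X x))) (at x)"
    using F by (simp_all add: has_real_derivative_iff_has_vector_derivative trunc_field_def case_prod_beta)
qed

lemma continuous_scl: "continuous_on S (\<lambda>z. scl (f z))" if "continuous_on S f"
  unfolding scl_def using that one_plus_sq_pos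
  by (intro continuous_on_powr continuous_intros ballI) (auto simp: less_imp_neq[THEN not_sym])

lemma continuous_trunc_inv_cube:
  assumes "0 < \<delta>" shows "continuous_on UNIV (trunc_inv_cube \<delta>)"
proof (rule lipschitz_on_continuous_on)
  show "(3 / \<delta> ^ 4)-lipschitz_on UNIV (trunc_inv_cube \<delta>)"
    using trunc_inv_cube_lipschitz[OF assms] assms by (intro lipschitz_onI) (auto simp: dist_real_def)
qed

lemma continuous_trunc_field:
  assumes "0 < \<delta>" shows "continuous_on UNIV (\<lambda>(x, y). trunc_field \<delta> a x y)"
proof -
  have "continuous_on UNIV (\<lambda>z :: real \<times> real \<times> real \<times> real.
      trunc_inv_cube \<delta> (scl (fst z) ^ 12 * fst (snd z)))"
    by (rule continuous_on_compose2[OF continuous_trunc_inv_cube[OF assms]])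
      (auto intro!: continuous_intros continuous_scl)
  then have "continuous_on UNIV (\<lambda>z :: real \<times> real \<times> real \<times> real.
      (fst (snd (snd z)), snd (snd (snd z)), third_rhs \<delta> a (fst z) (fst (snd z))))"
    unfolding third_rhs_def by (intro continuous_intros continuous_scl) auto
  then show ?thesis by (simp add: trunc_field_def case_prod_beta)
qed

definition trunc_lip :: "real \<Rightarrow> real \<Rightarrow> real" where
  "trunc_lip \<delta> x = 2 + scl x ^ 48 * (3 / \<delta> ^ 4)"

lemma continuous_trunc_lip: "continuous_on UNIV (trunc_lip \<delta>)"
  unfolding trunc_lip_def by (intro continuous_intros continuous_scl)

lemma trunc_field_lipschitz:
  assumes "0 < \<delta>"
  shows "norm (trunc_field \<delta> a x y - trunc_field \<delta> a x z) \<le> trunc_lip \<delta> x * norm (y - z)"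
proof -
  obtain u v w u' v' w' where yz: "y = (u, v, w)" "z = (u', v', w')" by (metis prod_cases3)
  have n: "\<bar>u - u'\<bar> \<le> norm (y - z)" "\<bar>v - v'\<bar> \<le> norm (y - z)" "\<bar>w - w'\<bar> \<le> norm (y - z)"
    unfolding yz using norm_fst_le[of "u - u'" "(v - v', w - w')"] norm_snd_le[of "(v - v', w - w')" "u - u'"]
      norm_fst_le[of "v - v'" "w - w'"] norm_snd_le[of "w - w'" "v - v'"] by auto
  have "\<bar>third_rhs \<delta> a x u - third_rhs \<delta> a x u'\<bar>
      = scl x ^ 36 * \<bar>trunc_inv_cube \<delta> (scl x ^ 12 * u) - trunc_inv_cube \<delta> (scl x ^ 12 * u')\<bar>"
    using scl_pos[of x] by (simp add: third_rhs_def abs_mult flip: right_diff_distrib)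
  also have "\<dots> \<le> scl x ^ 36 * (3 / \<delta> ^ 4 * \<bar>scl x ^ 12 * u - scl x ^ 12 * u'\<bar>)"
    using scl_pos[of x] by (intro mult_left_mono trunc_inv_cube_lipschitz assms) auto
  also have "\<bar>scl x ^ 12 * u - scl x ^ 12 * u'\<bar> = scl x ^ 12 * \<bar>u - u'\<bar>"
    using scl_pos[of x] by (simp add: abs_mult flip: right_diff_distrib)
  also have "scl x ^ 36 * (3 / \<delta> ^ 4 * (scl x ^ 12 * \<bar>u - u'\<bar>)) = scl x ^ 48 * (3 / \<delta> ^ 4) * \<bar>u - u'\<bar>"
    by (simp flip: power_add)
  also have "\<dots> \<le> scl x ^ 48 * (3 / \<delta> ^ 4) * norm (y - z)"
    using n scl_pos[of x] assms by (intro mult_left_mono) auto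
  finally have r: "\<bar>third_rhs \<delta> a x u - third_rhs \<delta> a x u'\<bar> \<le> scl x ^ 48 * (3 / \<delta> ^ 4) * norm (y - z)" .
  have "norm (trunc_field \<delta> a x y - trunc_field \<delta> a x z)
      = norm (v - v', w - w', third_rhs \<delta> a x u - third_rhs \<delta> a x u')"
    by (simp add: trunc_field_def yz)
  also have "\<dots> \<le> \<bar>v - v'\<bar> + (\<bar>w - w'\<bar> + \<bar>third_rhs \<delta> a x u - third_rhs \<delta> a x u'\<bar>)"
    using norm_Pair_le[of "v - v'"] norm_Pair_le[of "w - w'" "third_rhs \<delta> a x u - third_rhs \<delta> a x u'"]
    by (smt (verit) real_norm_def)
  also have "\<dots> \<le> trunc_lip \<delta> x * norm (y - z)"
    using n r unfolding trunc_lip_def by (simp add: distrib_right)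
  finally show ?thesis .
qed

lemma trunc_solution_exists:
  assumes "0 < \<delta>"
  obtains X where "trunc_solution \<delta> a X" "X x0 = y0"
  using global_ivp_solution[OF continuous_trunc_field continuous_trunc_lip trunc_field_lipschitz, OF assms assms]
  unfolding trunc_solution_def by metis

lemma trunc_solutions_close:
  assumes "0 < \<delta>"
  obtains c where "\<And>X Y. trunc_solution \<delta> a X \<Longrightarrow> trunc_solution \<delta> a Y \<Longrightarrow>
    norm (X x - Y x) \<le> c * norm (X x0 - Y x0)"
  using ivp_solutions_close[where V = "trunc_field \<delta> a", OF continuous_trunc_lip trunc_field_lipschitz[OF assms]]
  unfolding trunc_solution_def by blast

text \<open>Backwards in \<open>x\<close> the ordering of the second derivatives is preserved: as long as the difference
\<open>h\<close> is nonnegative, \<open>h'''\<close> is nonpositive because the nonlinearity decreases, so \<open>h''\<close> can only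
grow towards the left, and then so does \<open>h\<close>. The quadratic growth makes shooting surjective.\<close>

lemma trunc_solutions_diverge:
  assumes \<delta>: "0 < \<delta>" and X: "trunc_solution \<delta> a X" and Y: "trunc_solution \<delta> a Y"
    and XL: "X L = (u, v, w + d)" and YL: "Y L = (u, v, w)" and d: "d > 0" and x: "x \<le> L"
  shows "fst (X x) - fst (Y x) \<ge> d * (L - x)\<^sup>2 / 4"
proof -
  define h h1 h2 where "h x = fst (X x) - fst (Y x)" and "h1 x = fst (snd (X x)) - fst (snd (Y x))"
    and "h2 x = snd (snd (X x)) - snd (snd (Y x))" for x
  note D = trunc_solution_derivs[OF X] trunc_solution_derivs[OF Y]
  have h: "(h has_real_derivative h1 x) (at x)" and h1: "(h1 has_real_derivative h2 x) (at x)"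
    and h2: "(h2 has_real_derivative third_rhs \<delta> a x (fst (X x)) - third_rhs \<delta> a x (fst (Y x))) (at x)" for x
    unfolding h_def h1_def h2_def by (intro DERIV_diff D)+
  have init: "h L = 0" "h1 L = 0" "h2 L = d"
    by (simp_all add: h_def h1_def h2_def XL YL)
  have low: "h2 x > d / 2" if "x \<le> L" for x
  proof (rule ccontr)
    assume "\<not> h2 x > d / 2"
    \<comment> \<open>the supremum of this set is the last point before \<open>L\<close> at which \<open>h''\<close> is at most \<open>d / 2\<close>\<close>
    define S where "S = {y \<in> {x..L}. h2 y \<le> d / 2}"
    have ch2: "continuous_on A h2" for A
      by (meson h2 DERIV_isCont continuous_at_imp_continuous_on)
    have "S = {x..L} \<inter> {y. h2 y \<le> d / 2}" by (auto simp: S_def)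
    moreover have "closed {y. h2 y \<le> d / 2}" by (intro closed_Collect_le ch2 continuous_intros)
    ultimately have "compact S" by (simp add: compact_Int_closed)
    moreover have "x \<in> S" using \<open>\<not> h2 x > d / 2\<close> that by (simp add: S_def)
    ultimately obtain z where z: "z \<in> S" "\<And>y. y \<in> S \<Longrightarrow> y \<le> z"
      using compact_attains_sup[of S] by auto
    then have zL: "z \<le> L" "h2 z \<le> d / 2" by (auto simp: S_def)
    have p2: "h2 y \<ge> 0" if "y \<in> {z..L}" for y
    proof (rule ccontr)
      assume "\<not> h2 y \<ge> 0"
      then have "y \<in> S" using that z(1) d by (auto simp: S_def)
      then have "y = z" using z(2)[of y] that by simp
      obtain e where "e > 0" and e: "\<And>b. 0 < b \<Longrightarrow> b < e \<Longrightarrow> h2 (z + b) < d / 4"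
      proof -
        have "h2 z < d / 4" using \<open>\<not> h2 y \<ge> 0\<close> \<open>y = z\<close> d by simp
        then have "\<forall>\<^sub>F t in at z. h2 t < d / 4"
          using h2[of z] DERIV_isCont isCont_def order_tendstoD(2) by blast
        then show thesis using that unfolding eventually_at
          by (metis add_cancel_right_right add_diff_cancel_left' abs_of_pos dist_real_def less_irrefl UNIV_I)
      qed
      have "z < L" using zL init \<open>\<not> h2 y \<ge> 0\<close> \<open>y = z\<close> d by (cases "z = L") auto
      define b where "b = min (e / 2) (L - z)"
      have b: "0 < b" "b < e" "z + b \<le> L" using \<open>e > 0\<close> \<open>z < L\<close> by (auto simp: b_def)
      have "z + b \<in> S" using e[OF b(1,2)] b d z(1) by (auto simp: S_def)
      then show False using z(2) b(1) by force
    qed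
    have m1: "h1 y \<le> 0" if "y \<in> {z..L}" for y
      using DERIV_nonneg_imp_nondecreasing[of y L h1] h1 p2 that init by fastforce
    have m0: "h y \<ge> 0" if "y \<in> {z..L}" for y
      using DERIV_nonpos_imp_nonincreasing[of y L h] h m1 that init by fastforce
    have "third_rhs \<delta> a y (fst (X y)) - third_rhs \<delta> a y (fst (Y y)) \<le> 0" if "y \<in> {z..L}" for y
    proof -
      have "scl y ^ 12 * fst (Y y) \<le> scl y ^ 12 * fst (X y)"
        using m0[OF that] scl_pos[of y] by (simp add: h_def)
      then have "trunc_inv_cube \<delta> (scl y ^ 12 * fst (X y)) \<le> trunc_inv_cube \<delta> (scl y ^ 12 * fst (Y y))"
        using trunc_inv_cube_diff(1)[OF \<delta>] by simp
      then show ?thesis unfolding third_rhs_def using scl_pos[of y] by simp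
    qed
    then have "h2 z \<ge> h2 L"
      using DERIV_nonpos_imp_nonincreasing[of z L h2] h2 zL(1) by fastforce
    then show False using zL init d by simp
  qed
  have l1: "h1 y \<le> - (d / 2) * (L - y)" if "y \<le> L" for y
  proof -
    have "h1 y - d / 2 * y \<le> h1 L - d / 2 * L"
    proof (rule DERIV_nonneg_imp_nondecreasing[OF that])
      fix t assume "y \<le> t" "t \<le> L"
      have "((\<lambda>y. h1 y - d / 2 * y) has_real_derivative h2 t - d / 2) (at t)"
        by (rule derivative_eq_intros h1 refl | simp)+
      then show "\<exists>D. ((\<lambda>y. h1 y - d / 2 * y) has_real_derivative D) (at t) \<and> 0 \<le> D"
        using low[OF \<open>t \<le> L\<close>] by fastforce
    qed
    then have "h1 y \<le> d / 2 * y - d / 2 * L" using init by linarith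
    also have "\<dots> = - (d / 2) * (L - y)" by (simp add: field_simps)
    finally show ?thesis .
  qed
  have "h x - d * (L - x)\<^sup>2 / 4 \<ge> h L - d * (L - L)\<^sup>2 / 4"
  proof (rule DERIV_nonpos_imp_nonincreasing[OF x])
    fix t assume "x \<le> t" "t \<le> L"
    have "((\<lambda>x. h x - d * (L - x)\<^sup>2 / 4) has_real_derivative h1 t + d / 2 * (L - t)) (at t)"
      by (rule derivative_eq_intros h refl | simp add: field_simps)+
    then show "\<exists>D. ((\<lambda>x. h x - d * (L - x)\<^sup>2 / 4) has_real_derivative D) (at t) \<and> D \<le> 0"
      using l1[OF \<open>t \<le> L\<close>] by fastforce
  qed
  then show ?thesis using init by (simp add: h_def)
qed

text \<open>The value at \<open>-L\<close> depends continuously on the second derivative at \<open>L\<close> and, by the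
previous lemma, takes arbitrarily large positive and negative values.\<close>

lemma boundary_value_problem:
  assumes \<delta>: "0 < \<delta>" and L: "0 < L"
  obtains X where "trunc_solution \<delta> a X"
    "fst (X L) = u" "fst (snd (X L)) = v" "fst (X (- L)) = u'"
proof -
  have "\<exists>X. trunc_solution \<delta> a X \<and> X L = (u, v, s)" for s
    using trunc_solution_exists[OF \<delta>] by metis
  then obtain X where X: "\<And>s. trunc_solution \<delta> a (X s)" "\<And>s. X s L = (u, v, s)" by metis
  define f where "f s = fst (X s (- L))" for s
  obtain c where c: "\<And>X Y. trunc_solution \<delta> a X \<Longrightarrow> trunc_solution \<delta> a Y \<Longrightarrow>
    norm (X (- L) - Y (- L)) \<le> c * norm (X L - Y L)"
    using trunc_solutions_close[OF \<delta>] by blast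
  have lip: "\<bar>f s - f t\<bar> \<le> \<bar>c\<bar> * \<bar>s - t\<bar>" for s t
  proof -
    have "\<bar>f s - f t\<bar> \<le> norm (X s (- L) - X t (- L))"
      unfolding f_def by (metis fst_diff norm_fst_le prod.collapse real_norm_def)
    also have "\<dots> \<le> c * norm (X s L - X t L)" by (rule c[OF X(1) X(1)])
    also have "\<dots> = c * \<bar>s - t\<bar>" by (simp add: X(2) norm_Pair)
    also have "\<dots> \<le> \<bar>c\<bar> * \<bar>s - t\<bar>" by (intro mult_right_mono) auto
    finally show ?thesis .
  qed
  have cf: "continuous_on UNIV f"
    by (rule lipschitz_on_continuous_on[of "\<bar>c\<bar>"], rule lipschitz_onI) (auto simp: dist_real_def lip)
  have grow: "f (s + d) - f s \<ge> d * L\<^sup>2" if "d > 0" for s d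
    using trunc_solutions_diverge[OF \<delta> X(1)[of "s + d"] X(1)[of s] X(2) X(2) that, of "- L"] L
    by (simp add: f_def power2_eq_square)
  define M where "M = (\<bar>u' - f 0\<bar> + 1) / L\<^sup>2"
  have M: "M > 0" "M * L\<^sup>2 = \<bar>u' - f 0\<bar> + 1" using L by (auto simp: M_def)
  have "f (- M) \<le> u'" "u' \<le> f M" "- M \<le> M"
    using grow[of M 0] grow[of M "- M"] M by auto
  then obtain s where "f s = u'"
    using IVT'[of f "- M" u' M] continuous_on_subset[OF cf] by blast
  then show thesis
    using that[of "X s"] X by (simp add: f_def)
qed


section \<open>The energy estimate\<close>

text \<open>The energy is \<open>h'^2 / 2 - h * h''\<close>, increasing up to an integrable error that \<open>arctan\<close> makes up
for. At \<open>L\<close> it vanishes, since \<open>h\<close> and \<open>h'\<close> do; at \<open>-L\<close> it is nonnegative, since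
\<open>h\<close> vanishes. Its total increase, which dominates the weighted excess, is thus bounded independently
of \<open>L\<close> and \<open>\<delta>\<close>.\<close>

lemma boundary_value_energy:
  fixes a :: real
  obtains C where "C > 0"
    and "\<And>\<delta> L. 0 < \<delta> \<Longrightarrow> \<delta> \<le> 1 \<Longrightarrow> 0 < L \<Longrightarrow>
      \<exists>X E E'. trunc_solution \<delta> a X \<and> (\<forall>x. (E has_real_derivative E' x) (at x))
        \<and> (\<forall>x. E' x \<ge> scl x ^ 24 * excess \<delta> (scl x ^ 12 * fst (X x)) / 8)
        \<and> E L - E (- L) \<le> C"
proof -
  obtain G G1 G2 G3 \<sigma> \<gamma> :: "real \<Rightarrow> real" and C where
    G: "\<And>x. (G has_real_derivative G1 x) (at x)" "\<And>x. (G1 has_real_derivative G2 x) (at x)"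
      "\<And>x. (G2 has_real_derivative G3 x) (at x)"
    and G_eq: "\<And>x. G x = (1 + \<gamma> x) / scl x ^ 12"
    and \<rho>: "\<And>x. a + x\<^sup>2 + G3 x = (1 + \<sigma> x) * scl x ^ 36"
    and \<sigma>: "\<And>x. 1 + \<sigma> x \<ge> 1/2" and \<gamma>: "\<And>x. \<gamma> x \<ge> 0"
    and C: "\<And>x. scl x ^ 60 * ((\<sigma> x)\<^sup>2 + (\<gamma> x)\<^sup>2) \<le> C" "C > 0"
    using reference_profile[of a] by metis
  show thesis
  proof (rule that[of "200 * C * pi"])
    show "200 * C * pi > 0" using C by simp
    fix \<delta> L :: real assume \<delta>: "0 < \<delta>" "\<delta> \<le> 1" and L: "0 < L"
    obtain X where X: "trunc_solution \<delta> a X"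
      and bc: "fst (X L) = G L" "fst (snd (X L)) = G1 L" "fst (X (- L)) = G (- L)"
      using boundary_value_problem[OF \<delta>(1) L] by metis
    define h h1 h2 where "h x = fst (X x) - G x" and "h1 x = fst (snd (X x)) - G1 x"
      and "h2 x = snd (snd (X x)) - G2 x" for x
    define h3 where "h3 x = third_rhs \<delta> a x (fst (X x)) - G3 x" for x
    note D = trunc_solution_derivs[OF X]
    have h: "(h has_real_derivative h1 x) (at x)" and h1: "(h1 has_real_derivative h2 x) (at x)"
      and h2: "(h2 has_real_derivative h3 x) (at x)" for x
      unfolding h_def h1_def h2_def h3_def by (intro DERIV_diff D G)+
    define E where "E x = (h1 x)\<^sup>2 / 2 - h x * h2 x + 200 * C * arctan x" for x
    define E' where "E' x = - h x * h3 x + 200 * C / (1 + x\<^sup>2)" for x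
    have E: "(E has_real_derivative E' x) (at x)" for x
      unfolding E_def E'_def
      by (rule derivative_eq_intros h h1 h2 refl | simp add: field_simps)+
    have dens: "E' x \<ge> scl x ^ 24 * excess \<delta> (scl x ^ 12 * fst (X x)) / 8" for x
    proof -
      define y u where "y = scl x" and "u = y ^ 12 * fst (X x)"
      have y: "y > 0" "y ^ 36 = 1 + x\<^sup>2" unfolding y_def using scl_pos scl_power_36 by auto
      define i where "i = (1 + \<sigma> x - trunc_inv_cube \<delta> u) * (u - 1 - \<gamma> x)"
      have i: "i \<ge> excess \<delta> u / 8 - 200 * ((\<sigma> x)\<^sup>2 + (\<gamma> x)\<^sup>2)"
        unfolding i_def by (rule energy_density_ge[OF \<delta> \<sigma> \<gamma>])
      have hu: "y ^ 12 * h x = u - 1 - \<gamma> x"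
        unfolding h_def u_def G_eq y_def[symmetric] using y by (simp add: right_diff_distrib)
      have h3u: "h3 x = - (y ^ 36 * (1 + \<sigma> x - trunc_inv_cube \<delta> u))"
        unfolding h3_def third_rhs_def u_def y_def using \<rho>[of x] by (simp add: algebra_simps)
      have "- h x * h3 x = y ^ 24 * i"
      proof -
        have "- h x * h3 x = y ^ 24 * (1 + \<sigma> x - trunc_inv_cube \<delta> u) * (y ^ 12 * h x)"
          unfolding h3u by (simp add: mult_ac flip: power_add)
        then show ?thesis by (simp add: hu i_def)
      qed
      moreover have "y ^ 24 * (excess \<delta> u / 8 - 200 * ((\<sigma> x)\<^sup>2 + (\<gamma> x)\<^sup>2)) \<le> y ^ 24 * i"
        using i y by (intro mult_left_mono) auto
      moreover have "y ^ 24 * (200 * ((\<sigma> x)\<^sup>2 + (\<gamma> x)\<^sup>2)) \<le> 200 * C / (1 + x\<^sup>2)"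
      proof -
        have "y ^ 24 * (200 * ((\<sigma> x)\<^sup>2 + (\<gamma> x)\<^sup>2)) * y ^ 36 = 200 * (y ^ 60 * ((\<sigma> x)\<^sup>2 + (\<gamma> x)\<^sup>2))"
          by (simp add: mult_ac flip: power_add)
        also have "\<dots> \<le> 200 * C" using C(1)[of x] by (simp add: y_def)
        finally show ?thesis using y(1) by (simp only: pos_le_divide_eq y(2)[symmetric] zero_less_power)
      qed
      moreover have "y ^ 24 * (excess \<delta> u / 8 - 200 * ((\<sigma> x)\<^sup>2 + (\<gamma> x)\<^sup>2))
          = y ^ 24 * excess \<delta> u / 8 - y ^ 24 * (200 * ((\<sigma> x)\<^sup>2 + (\<gamma> x)\<^sup>2))"
        by (simp add: algebra_simps)
      ultimately show ?thesis unfolding E'_def u_def y_def by argo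
    qed
    have "E L - E (- L) \<le> 200 * C * arctan L - 200 * C * arctan (- L)"
      by (simp add: E_def h_def h1_def bc)
    also have "\<dots> = 200 * C * (2 * arctan L)" by (simp add: arctan_minus)
    also have "\<dots> \<le> 200 * C * pi"
      using arctan_ubound[of L] C(2) by (intro mult_left_mono) auto
    finally have EL: "E L - E (- L) \<le> 200 * C * pi" .
    show "\<exists>X E E'. trunc_solution \<delta> a X \<and> (\<forall>x. (E has_real_derivative E' x) (at x))
        \<and> (\<forall>x. E' x \<ge> scl x ^ 24 * excess \<delta> (scl x ^ 12 * fst (X x)) / 8)
        \<and> E L - E (- L) \<le> 200 * C * pi"
      using X E dens EL by blast
  qed
qed

section \<open>From the energy to pointwise bounds\<close>

text \<open>Interpolation: three separated points at which a function is small, and a bound for the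
oscillation of its second derivative, control the value and both derivatives at the centre. Up to the
oscillation the function is a quadratic polynomial, which divided differences recover from three
values.\<close>

lemma three_point_bounds:
  fixes w w1 w2 :: "real \<Rightarrow> real"
  assumes w: "\<And>x. (w has_real_derivative w1 x) (at x)" "\<And>x. (w1 has_real_derivative w2 x) (at x)"
    and r: "r > 0"
    and M: "\<And>x. \<bar>x - c\<bar> \<le> r \<Longrightarrow> \<bar>w2 x - w2 c\<bar> \<le> M"
    and t: "- r \<le> t1" "t1 \<le> - r / 2" "- r / 4 \<le> t2" "t2 \<le> r / 4" "r / 2 \<le> t3" "t3 \<le> r"
    and small: "\<bar>w (c + t1)\<bar> \<le> l" "\<bar>w (c + t2)\<bar> \<le> l" "\<bar>w (c + t3)\<bar> \<le> l"
    and B: "l + M * r\<^sup>2 / 2 \<le> B"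
  shows "\<bar>w2 c\<bar> \<le> 96 * B / r\<^sup>2" "\<bar>w1 c\<bar> \<le> 50 * B / r" "\<bar>w c\<bar> \<le> 99 * B"
proof -
  define Q where "Q t = w c + w1 c * t + w2 c * t\<^sup>2 / 2" for t
  have taylor: "\<bar>w (c + t) - Q t\<bar> \<le> M * r\<^sup>2 / 2" if "\<bar>t\<bar> \<le> r" for t
  proof (cases "t = 0")
    case True
    then show ?thesis using M[of c] r by (simp add: Q_def)
  next
    case False
    define f where "f m = (if m = 0 then w else if m = 1 then w1 else w2)" for m :: nat
    have "\<forall>m x. m < 2 \<and> c - r \<le> x \<and> x \<le> c + r \<longrightarrow> (f m has_real_derivative f (Suc m) x) (at x)"
      using w by (auto simp: f_def)
    moreover have "f 0 = w" by (simp add: f_def)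
    moreover have "c - r \<le> c" "c \<le> c + r" "c - r \<le> c + t" "c + t \<le> c + r" "c + t \<noteq> c"
      using that False r by (auto simp: abs_le_iff)
    ultimately obtain s where s: "if c + t < c then c + t < s \<and> s < c else c < s \<and> s < c + t"
      and eq: "w (c + t) = (\<Sum>m<2. f m c / fact m * (c + t - c) ^ m) + f 2 s / fact 2 * (c + t - c)\<^sup>2"
      using Taylor[of 2 f w "c - r" "c + r" c "c + t"] by auto
    have "w (c + t) = w c + w1 c * t + w2 s * t\<^sup>2 / 2"
      unfolding eq by (simp add: f_def numeral_2_eq_2)
    then have "w (c + t) - Q t = (w2 s - w2 c) * t\<^sup>2 / 2"
      by (simp add: Q_def algebra_simps diff_divide_distrib)
    then have "\<bar>w (c + t) - Q t\<bar> = \<bar>w2 s - w2 c\<bar> * \<bar>t\<bar>\<^sup>2 / 2"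
      by (simp only: abs_mult abs_divide power_abs abs_numeral)
    also have "\<dots> \<le> M * r\<^sup>2 / 2"
    proof -
      have "\<bar>s - c\<bar> \<le> r" using s that by (auto split: if_splits)
      then have "\<bar>w2 s - w2 c\<bar> \<le> M" by (rule M)
      then show ?thesis using that by (intro divide_right_mono mult_mono power_mono) auto
    qed
    finally show ?thesis .
  qed
  have Q: "\<bar>Q t1\<bar> \<le> B" "\<bar>Q t2\<bar> \<le> B" "\<bar>Q t3\<bar> \<le> B"
  proof -
    have "\<bar>t1\<bar> \<le> r" "\<bar>t2\<bar> \<le> r" "\<bar>t3\<bar> \<le> r" using t r by auto
    then show "\<bar>Q t1\<bar> \<le> B" "\<bar>Q t2\<bar> \<le> B" "\<bar>Q t3\<bar> \<le> B"
      using taylor[of t1] taylor[of t2] taylor[of t3] small B by argo+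
  qed
  then have B0: "B \<ge> 0" by linarith
  have quot: "\<bar>(Q s - Q t) / (s - t)\<bar> \<le> 2 * B / d"
    if "\<bar>Q s\<bar> \<le> B" "\<bar>Q t\<bar> \<le> B" "s - t \<ge> d" "d > 0" for s t d
  proof -
    have "\<bar>Q s - Q t\<bar> \<le> 2 * B" using that by linarith
    then show ?thesis unfolding abs_divide using that B0 by (intro frac_le) auto
  qed
  have slope: "(Q s - Q t) / (s - t) = w1 c + w2 c * (s + t) / 2" if "s \<noteq> t" for s t
  proof -
    have "Q s - Q t = (w1 c + w2 c * (s + t) / 2) * (s - t)"
      by (simp add: Q_def power2_eq_square field_simps)
    then show ?thesis using that by simp
  qed
  have s21: "\<bar>w1 c + w2 c * (t2 + t1) / 2\<bar> \<le> 8 * B / r"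
    using quot[OF Q(2,1), of "r / 4"] t r slope[of t2 t1] by simp
  have s32: "\<bar>w1 c + w2 c * (t3 + t2) / 2\<bar> \<le> 8 * B / r"
    using quot[OF Q(3,2), of "r / 4"] t r slope[of t3 t2] by simp
  have "\<bar>w2 c * (t3 - t1) / 2\<bar> \<le> 16 * B / r"
  proof -
    have "w2 c * (t3 - t1) / 2 = (w1 c + w2 c * (t3 + t2) / 2) - (w1 c + w2 c * (t2 + t1) / 2)"
      by (simp add: field_simps)
    then show ?thesis using s21 s32 by argo
  qed
  moreover have "\<bar>w2 c\<bar> * r / 2 \<le> \<bar>w2 c * (t3 - t1) / 2\<bar>"
    using t r by (simp add: abs_mult mult_left_mono)
  ultimately have "\<bar>w2 c\<bar> * r \<le> 32 * B / r" by argo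
  then have "\<bar>w2 c\<bar> * r\<^sup>2 \<le> 32 * B" using r by (simp add: field_simps power2_eq_square)
  then have w2: "\<bar>w2 c\<bar> \<le> 32 * B / r\<^sup>2" using r by (simp add: field_simps)
  also have "\<dots> \<le> 96 * B / r\<^sup>2" using B0 by (intro divide_right_mono) auto
  finally show "\<bar>w2 c\<bar> \<le> 96 * B / r\<^sup>2" .
  have "\<bar>w2 c * (t3 + t2) / 2\<bar> \<le> 32 * B / r"
  proof -
    have "\<bar>w2 c * (t3 + t2) / 2\<bar> = \<bar>w2 c\<bar> * \<bar>t3 + t2\<bar> / 2" by (simp add: abs_mult)
    also have "\<dots> \<le> 32 * B / r\<^sup>2 * (2 * r) / 2"
      using w2 t r by (intro divide_right_mono mult_mono) auto
    also have "\<dots> = 32 * B / r" using r by (simp add: power2_eq_square)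
    finally show ?thesis .
  qed
  then have w1: "\<bar>w1 c\<bar> \<le> 40 * B / r" using s32 by argo
  also have "\<dots> \<le> 50 * B / r" using B0 r by (intro divide_right_mono) auto
  finally show "\<bar>w1 c\<bar> \<le> 50 * B / r" .
  have "\<bar>w1 c * t2\<bar> \<le> 40 * B / r * r"
    unfolding abs_mult using w1 t r by (intro mult_mono) auto
  moreover have "\<bar>w2 c * t2\<^sup>2\<bar> \<le> 32 * B / r\<^sup>2 * r\<^sup>2"
    unfolding abs_mult using w2 t r by (intro mult_mono) (auto simp: abs_le_square_iff[symmetric])
  ultimately have "\<bar>w1 c * t2\<bar> \<le> 40 * B" "\<bar>w2 c * t2\<^sup>2\<bar> \<le> 32 * B" using r by auto
  then show "\<bar>w c\<bar> \<le> 99 * B" using Q(2) B0 unfolding Q_def by argo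
qed

text \<open>On windows of length one the weights are constant up to a factor, so they may be moved to the
centre of the window.\<close>

lemma scl_window:
  assumes "\<bar>x - z\<bar> \<le> 1" "n \<le> 36"
  shows "scl x ^ n \<le> 3 * scl z ^ n"
proof (cases "scl x \<le> scl z")
  case True
  then have "scl x ^ n \<le> scl z ^ n" using scl_pos[of x] by (intro power_mono) auto
  then show ?thesis using scl_pos[of z] by (smt (verit) zero_less_power)
next
  case False
  have "0 \<le> (x - 2 * z)\<^sup>2" "(x - z)\<^sup>2 \<le> 1" using assms by (auto simp: abs_square_le_1)
  then have "x\<^sup>2 \<le> 2 + 2 * z\<^sup>2" by (simp add: power2_eq_square algebra_simps)
  then have "1 + x\<^sup>2 \<le> 3 * (1 + z\<^sup>2)" using zero_le_power2[of z] by argo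
  then have "scl x ^ 36 \<le> 3 * scl z ^ 36" by (simp add: scl_power_36)
  then have "(scl x / scl z) ^ 36 \<le> 3" using scl_pos[of z] by (simp add: power_divide divide_le_eq)
  moreover have "(scl x / scl z) ^ n \<le> (scl x / scl z) ^ 36"
    using False scl_pos[of z] assms by (intro power_increasing) auto
  ultimately have "(scl x / scl z) ^ n \<le> 3" by simp
  then show ?thesis using scl_pos[of z] by (simp add: power_divide divide_le_eq)
qed

lemma trunc_inv_cube_nonneg: "0 < \<delta> \<Longrightarrow> 0 \<le> trunc_inv_cube \<delta> u"
  unfolding trunc_inv_cube_def by (auto intro!: add_nonneg_nonneg)

text \<open>Inverts the lower bound of \<open>excess\<close>; the square root of \<open>1 / y^6\<close> is where half of the
decay is lost.\<close>

lemma deviation_bound: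
  fixes f y D :: real
  assumes "f\<^sup>2 / (1 + \<bar>f\<bar>) \<le> D / y ^ 6" "D \<ge> 1" "y \<ge> 1"
  shows "\<bar>f\<bar> \<le> 2 * D / y ^ 3"
proof (rule ccontr)
  define t where "t = D / y ^ 3"
  assume "\<not> \<bar>f\<bar> \<le> 2 * D / y ^ 3"
  then have f: "\<bar>f\<bar> > 2 * t" by (simp add: t_def)
  have t0: "t > 0" using assms by (simp add: t_def)
  have y6: "y ^ 6 = y ^ 3 * y ^ 3" by (simp flip: power_add)
  have 1: "D / y ^ 6 \<le> t" unfolding t_def using assms by (intro divide_left_mono power_increasing) auto
  have "D \<le> D * D" using assms by simp
  then have 2: "D / y ^ 6 \<le> t * t" unfolding t_def y6 times_divide_times_eq
    using assms by (intro divide_right_mono) auto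
  have "f\<^sup>2 \<le> D / y ^ 6 * (1 + \<bar>f\<bar>)" using assms(1) by (simp add: pos_divide_le_eq)
  also have "\<dots> = D / y ^ 6 + D / y ^ 6 * \<bar>f\<bar>" by (simp add: distrib_left)
  also have "\<dots> \<le> t * t + t * \<bar>f\<bar>" using 1 2 by (intro add_mono mult_right_mono) auto
  also have "\<dots> < \<bar>f\<bar> / 2 * (\<bar>f\<bar> / 2) + \<bar>f\<bar> / 2 * \<bar>f\<bar>"
    using f t0 by (intro add_strict_mono mult_strict_right_mono mult_strict_mono) auto
  also have "\<dots> = 3 / 4 * f\<^sup>2" by (simp add: power2_eq_square abs_mult_self_eq)
  finally show False using zero_le_power2[of f] by simp
qed

text \<open>With \<open>y = scl c\<close> the natural length at \<open>c\<close> is \<open>y^(-16)\<close>, and the natural sizes of the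
solution and its derivatives are \<open>y^(-12)\<close>, \<open>y^4\<close> and \<open>y^20\<close>; the estimate gains a factor
\<open>1/y\<close> for each of them. On a window shorter than the natural length by the factor
\<open>1/y\<close>, the mean value theorem for the energy provides three points at which the excess is at most of order
\<open>y^(-6)\<close>, hence the deviation from the far field of order \<open>y^(-15)\<close>. The third derivative is
bounded by \<open>y^36\<close> plus a multiple of the derivative of the energy, so the second derivative
oscillates by at most order \<open>y^19\<close>. Interpolation on the window combines the two. The constant does not
depend on \<open>\<delta>\<close>.\<close>

lemma window_estimate:
  fixes a CE :: real
  assumes CE: "CE > 0"
  obtains C where "C \<ge> 1"
    and "\<And>\<delta> X E E' c. 0 < \<delta> \<Longrightarrow> \<delta> \<le> 1 \<Longrightarrow> trunc_solution \<delta> a X \<Longrightarrow>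
      (\<And>x. (E has_real_derivative E' x) (at x)) \<Longrightarrow>
      (\<And>x. E' x \<ge> scl x ^ 24 * excess \<delta> (scl x ^ 12 * fst (X x)) / 8) \<Longrightarrow>
      E (c + 1) - E (c - 1) \<le> CE \<Longrightarrow>
      \<bar>fst (X c) - far c\<bar> \<le> C / scl c ^ 13 \<and> \<bar>fst (snd (X c)) - far1 c\<bar> \<le> C * scl c ^ 3
        \<and> \<bar>snd (snd (X c)) - far2 c\<bar> \<le> C * scl c ^ 19"
proof -
  define D A B where "D = 48 * CE + 1" and "A = 3 * (\<bar>a\<bar> + 23)" and "B = 6 * D + (A + 48 * CE)"
  have pos: "D \<ge> 1" "A \<ge> 0" "B \<ge> 1" using CE by (auto simp: D_def A_def B_def)
  show thesis
  proof (rule that[of "99 * B"])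
    show "99 * B \<ge> 1" using pos by simp
    fix \<delta> X E E' c
    assume \<delta>: "0 < \<delta>" "\<delta> \<le> 1" and X: "trunc_solution \<delta> a X"
      and E: "\<And>x. (E has_real_derivative E' x) (at x)"
      and dens: "\<And>x. E' x \<ge> scl x ^ 24 * excess \<delta> (scl x ^ 12 * fst (X x)) / 8"
      and total: "E (c + 1) - E (c - 1) \<le> CE"
    define y where "y = scl c"
    have y1: "y \<ge> 1" unfolding y_def by (rule scl_ge_1)
    then have y0: "y > 0" by simp
    have pw: "y ^ 36 = y ^ 19 * y ^ 17" "y ^ 15 = y ^ 12 * y ^ 3" "y ^ 34 = y ^ 19 * y ^ 15"
      "y ^ 17 = y ^ 2 * y ^ 15" by (simp_all flip: power_add)
    define r where "r = 1 / y ^ 17"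
    have r: "0 < r" "r \<le> 1" using y1 by (auto simp: r_def one_le_power)
    have r2: "r\<^sup>2 = 1 / (y ^ 19 * y ^ 15)"
      by (simp add: r_def power_divide flip: power_mult power_add)
    have cancel: "p * q * (1 / (q * s)) = p / s" if "q \<noteq> 0" for p q s :: real
      using that by simp
    have E0: "E' x \<ge> 0" for x
      using dens[of x] excess_nonneg[OF \<delta>] scl_pos[of x]
      by (smt (verit) divide_nonneg_nonneg mult_nonneg_nonneg zero_less_power)
    have mono: "E s \<le> E t" if "s \<le> t" for s t
      using DERIV_nonneg_imp_nondecreasing[OF that] E E0 by blast
    have part: "E t - E s \<le> CE" if "c - 1 \<le> s" "t \<le> c + 1" for s t
      using mono[OF that(1)] mono[OF that(2)] total by simp
    define w w1 w2 where "w x = fst (X x) - far x" and "w1 x = fst (snd (X x)) - far1 x"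
      and "w2 x = snd (snd (X x)) - far2 x" for x
    note DX = trunc_solution_derivs[OF X]
    have w: "(w has_real_derivative w1 x) (at x)" "(w1 has_real_derivative w2 x) (at x)"
      and w2: "(w2 has_real_derivative third_rhs \<delta> a x (fst (X x)) - far3 x) (at x)" for x
      unfolding w_def w1_def w2_def by (intro DERIV_diff DX far_deriv far1_deriv far2_deriv)+
    have point: "\<exists>t. s1 \<le> t \<and> t \<le> s2 \<and> \<bar>w (c + t)\<bar> \<le> 6 * D / y ^ 15"
      if s: "- r \<le> s1" "s2 \<le> r" "s2 - s1 \<ge> r / 2" for s1 s2
    proof -
      have "c + s1 < c + s2" using s r by simp
      then obtain z where z: "c + s1 < z" "z < c + s2" "E (c + s2) - E (c + s1) = (c + s2 - (c + s1)) * E' z"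
        using MVT2[of "c + s1" "c + s2" E E'] E by blast
      have "r / 2 * E' z \<le> (s2 - s1) * E' z" using s E0 by (intro mult_right_mono) auto
      also have "\<dots> \<le> CE" using z(3) part[of "c + s1" "c + s2"] s r by simp
      finally have Ez: "E' z \<le> 2 * CE * y ^ 17" using y0 by (simp add: r_def field_simps)
      define u where "u = scl z ^ 12 * fst (X z)"
      have near: "\<bar>c - z\<bar> \<le> 1" using z s r by (auto simp: abs_le_iff)
      have "y ^ 24 * excess \<delta> u \<le> 3 * scl z ^ 24 * excess \<delta> u"
        unfolding y_def by (intro mult_right_mono scl_window near excess_nonneg \<delta>) auto
      also have "\<dots> \<le> 24 * E' z" using dens[of z] by (simp add: u_def)
      also have "\<dots> \<le> 48 * CE * y ^ 17" using Ez by simp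
      also have "\<dots> \<le> D * y ^ 18"
        unfolding D_def using CE y1 by (intro mult_mono power_increasing) auto
      finally have "excess \<delta> u * y ^ 24 \<le> D * y ^ 18" by (simp add: mult.commute)
      then have "excess \<delta> u * y ^ 6 * y ^ 18 \<le> D * y ^ 18" by (simp add: mult.assoc flip: power_add)
      then have "excess \<delta> u \<le> D / y ^ 6"
        using y0 by (simp only: mult_le_cancel_right_pos zero_less_power pos_le_divide_eq)
      then have "\<bar>u - 1\<bar> \<le> 2 * D / y ^ 3"
        using deviation_bound[OF order_trans[OF excess_ge[OF \<delta>]]] pos y1 by blast
      moreover have "scl z ^ 12 * w z = u - 1"
        unfolding w_def u_def far_eq using scl_pos[of z] by (simp add: right_diff_distrib)
      then have "scl z ^ 12 * \<bar>w z\<bar> = \<bar>u - 1\<bar>"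
        using scl_pos[of z] by (metis abs_mult abs_of_pos zero_less_power)
      moreover have "y ^ 12 * \<bar>w z\<bar> \<le> 3 * scl z ^ 12 * \<bar>w z\<bar>"
        unfolding y_def by (intro mult_right_mono scl_window near) auto
      ultimately have "y ^ 12 * \<bar>w z\<bar> \<le> 6 * D / y ^ 3" by simp
      then have "\<bar>w z\<bar> \<le> 6 * D / y ^ 15"
        unfolding pw(2) using y0 by (simp add: field_simps)
      then show ?thesis using z by (intro exI[of _ "z - c"]) auto
    qed
    obtain t1 where t1: "- r \<le> t1" "t1 \<le> - r / 2" "\<bar>w (c + t1)\<bar> \<le> 6 * D / y ^ 15"
      using point[of "- r" "- r / 2"] r by auto
    obtain t2 where t2: "- r / 4 \<le> t2" "t2 \<le> r / 4" "\<bar>w (c + t2)\<bar> \<le> 6 * D / y ^ 15"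
      using point[of "- r / 4" "r / 4"] r by auto
    obtain t3 where t3: "r / 2 \<le> t3" "t3 \<le> r" "\<bar>w (c + t3)\<bar> \<le> 6 * D / y ^ 15"
      using point[of "r / 2" "r"] r by auto
    have w3: "\<bar>third_rhs \<delta> a x (fst (X x)) - far3 x\<bar> \<le> A * y ^ 36 + 48 * y ^ 12 * E' x"
      if "\<bar>x - c\<bar> \<le> 1" for x
    proof -
      define k where "k = trunc_inv_cube \<delta> (scl x ^ 12 * fst (X x))"
      define j where "j = excess \<delta> (scl x ^ 12 * fst (X x))"
      define z where "z = scl x"
      have z: "z > 0" "z ^ 36 = 1 + x\<^sup>2" unfolding z_def using scl_pos scl_power_36 by auto
      have k: "0 \<le> k" "k \<le> 8 + 2 * j" unfolding k_def j_def
        using trunc_inv_cube_nonneg trunc_inv_cube_le_excess \<delta> by auto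
      have "\<bar>third_rhs \<delta> a x (fst (X x)) - far3 x\<bar> \<le> z ^ 36 * k + (\<bar>a\<bar> + x\<^sup>2 + 14)"
      proof -
        have "z ^ 36 * k \<ge> 0" using z k by simp
        then show ?thesis using far3_bound[of x] zero_le_power2[of x]
          unfolding third_rhs_def k_def z_def by argo
      qed
      also have "\<dots> \<le> z ^ 36 * (8 + 2 * j) + z ^ 36 * (\<bar>a\<bar> + 15)"
      proof (rule add_mono)
        show "z ^ 36 * k \<le> z ^ 36 * (8 + 2 * j)" using z k by (intro mult_left_mono) auto
        show "\<bar>a\<bar> + x\<^sup>2 + 14 \<le> z ^ 36 * (\<bar>a\<bar> + 15)"
          unfolding z(2) by (simp add: algebra_simps)
      qed
      also have "\<dots> = z ^ 36 * (\<bar>a\<bar> + 23) + 2 * z ^ 12 * (z ^ 24 * j)"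
        by (simp add: power_add[of z 12 24, simplified] algebra_simps)
      also have "\<dots> \<le> 3 * y ^ 36 * (\<bar>a\<bar> + 23) + 2 * (3 * y ^ 12) * (8 * E' x)"
      proof (rule add_mono)
        show "z ^ 36 * (\<bar>a\<bar> + 23) \<le> 3 * y ^ 36 * (\<bar>a\<bar> + 23)"
          unfolding z_def y_def by (intro mult_right_mono scl_window that) auto
        have "z ^ 12 \<le> 3 * y ^ 12" unfolding z_def y_def by (rule scl_window[OF that]) simp
        moreover have "z ^ 24 * j \<le> 8 * E' x" using dens[of x] by (simp add: z_def j_def)
        moreover have "0 \<le> z ^ 24 * j" using z excess_nonneg[OF \<delta>] by (simp add: j_def)
        ultimately show "2 * z ^ 12 * (z ^ 24 * j) \<le> 2 * (3 * y ^ 12) * (8 * E' x)"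
          using z y0 by (intro mult_mono[of "2 * z ^ 12" "2 * (3 * y ^ 12)"]) auto
      qed
      also have "\<dots> = A * y ^ 36 + 48 * y ^ 12 * E' x" by (simp add: A_def)
      finally show ?thesis .
    qed
    define M where "M = (A + 48 * CE) * y ^ 19"
    have inc: "\<bar>w2 t - w2 s\<bar> \<le> M" if "s \<le> t" "c - r \<le> s" "t \<le> c + r" "t - s \<le> r" for s t
    proof -
      have "norm (w2 t - w2 s) \<le> (A * y ^ 36 * t + 48 * y ^ 12 * E t) - (A * y ^ 36 * s + 48 * y ^ 12 * E s)"
      proof (rule norm_increment_le[OF that(1)])
        show "(w2 has_vector_derivative third_rhs \<delta> a x (fst (X x)) - far3 x) (at x)" for x
          using w2 by (simp add: has_real_derivative_iff_has_vector_derivative)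
        show "((\<lambda>x. A * y ^ 36 * x + 48 * y ^ 12 * E x) has_real_derivative A * y ^ 36 + 48 * y ^ 12 * E' x) (at x)" for x
          by (rule derivative_eq_intros E refl | simp)+
        show "norm (third_rhs \<delta> a x (fst (X x)) - far3 x) \<le> A * y ^ 36 + 48 * y ^ 12 * E' x"
          if "x \<in> {s..t}" for x
          using w3[of x] that \<open>c - r \<le> s\<close> \<open>t \<le> c + r\<close> r by (simp add: abs_le_iff)
      qed
      also have "\<dots> = A * y ^ 36 * (t - s) + 48 * y ^ 12 * (E t - E s)" by (simp add: algebra_simps)
      also have "\<dots> \<le> A * y ^ 36 * r + 48 * y ^ 12 * CE"
        using that part[of s t] r y0 pos by (intro add_mono mult_left_mono) auto
      also have "A * y ^ 36 * r = A * y ^ 19"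
      proof -
        have "A * y ^ 36 * r = A * y ^ 19 * (y ^ 17 * (1 / y ^ 17))" by (simp only: r_def pw(1) mult.assoc)
        then show ?thesis using y0 by simp
      qed
      also have "48 * y ^ 12 * CE \<le> 48 * y ^ 19 * CE"
        using y1 CE by (intro mult_right_mono mult_left_mono power_increasing) auto
      finally show ?thesis by (simp add: M_def algebra_simps)
    qed
    have M: "\<bar>w2 x - w2 c\<bar> \<le> M" if "\<bar>x - c\<bar> \<le> r" for x
      using inc[of c x] inc[of x c] that r by (cases "c \<le> x") (auto simp: abs_minus_commute abs_le_iff)
    have BB: "6 * D / y ^ 15 + M * r\<^sup>2 / 2 \<le> B / y ^ 15"
    proof -
      have "M * r\<^sup>2 = (A + 48 * CE) / y ^ 15"
        unfolding M_def r2 by (rule cancel) (use y0 in simp)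
      moreover have "0 \<le> (A + 48 * CE) / y ^ 15" using pos CE y0 by simp
      moreover have "B / y ^ 15 = 6 * D / y ^ 15 + (A + 48 * CE) / y ^ 15"
        unfolding B_def by (rule add_divide_distrib)
      ultimately show ?thesis by linarith
    qed
    note W = three_point_bounds[OF w r(1) M t1(1,2) t2(1,2) t3(1,2) t1(3) t2(3) t3(3) BB]
    have "\<bar>w c\<bar> \<le> 99 * B / y ^ 13"
    proof -
      have "99 * (B / y ^ 15) \<le> 99 * (B / y ^ 13)"
        using pos y1 by (intro mult_left_mono divide_left_mono power_increasing) auto
      then show ?thesis using W(3) by simp
    qed
    moreover have "\<bar>w1 c\<bar> \<le> 99 * B * y ^ 3"
    proof -
      have "50 * (B / y ^ 15) / r = 50 * B * y ^ 2"
      proof -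
        have "y ^ 17 / y ^ 15 = y\<^sup>2" unfolding pw(4) using y0 by (intro nonzero_mult_div_cancel_right) simp
        moreover have "50 * (B / y ^ 15) / r = 50 * B * (y ^ 17 / y ^ 15)" by (simp add: r_def)
        ultimately show ?thesis by simp
      qed
      also have "\<dots> \<le> 99 * B * y ^ 3"
        using pos y1 by (intro mult_mono power_increasing) auto
      finally show ?thesis using W(2) by simp
    qed
    moreover have "\<bar>w2 c\<bar> \<le> 99 * B * y ^ 19"
    proof -
      have "96 * (B / y ^ 15) / r\<^sup>2 = 96 * B * y ^ 19"
      proof -
        have "96 * (B / y ^ 15) / r\<^sup>2 = 96 * B * (y ^ 34 / y ^ 15)"
          unfolding r_def by (simp add: power_divide flip: power_mult)
        also have "y ^ 34 / y ^ 15 = y ^ 19" unfolding pw(3) using y0 by (intro nonzero_mult_div_cancel_right) simp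
        finally show ?thesis .
      qed
      also have "\<dots> \<le> 99 * B * y ^ 19" using pos y0 by (intro mult_right_mono) auto
      finally show ?thesis using W(1) by simp
    qed
    ultimately show "\<bar>fst (X c) - far c\<bar> \<le> 99 * B / scl c ^ 13 \<and> \<bar>fst (snd (X c)) - far1 c\<bar> \<le> 99 * B * scl c ^ 3
        \<and> \<bar>snd (snd (X c)) - far2 c\<bar> \<le> 99 * B * scl c ^ 19"
      unfolding w_def w1_def w2_def y_def by blast
  qed
qed


section \<open>Absence of touchdown and the entire solution\<close>

text \<open>Crude bounds: the rescaled derivatives of the far field decay much faster than the estimates
require.\<close>

lemma far1_far2_bounds: "\<bar>far1 x\<bar> \<le> 1" "\<bar>far2 x\<bar> \<le> 3"
proof -
  let ?q = "1 + x\<^sup>2"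
  have q1: "?q \<ge> 1" by (rule one_plus_sq_ge_1)
  have x: "\<bar>x\<bar> \<le> ?q" using sum_squares_bound[of 1 "\<bar>x\<bar>"] by (simp add: power2_eq_square)
  have m: "?q powr (-1) * ?q = 1" using one_plus_sq_pos[of x] by (simp add: powr_minus_divide)
  have p: "?q powr (-4/3) \<le> ?q powr (-1)" "?q powr (-7/3) \<le> ?q powr (-1)" "?q powr (-4/3) \<le> 1"
  proof -
    show "?q powr (-4/3) \<le> ?q powr (-1)" "?q powr (-7/3) \<le> ?q powr (-1)"
      by (rule powr_mono; use q1 in simp)+
    have "?q powr (-4/3) \<le> ?q powr 0" by (rule powr_mono; use q1 in simp)
    then show "?q powr (-4/3) \<le> 1" using one_plus_sq_pos[of x] by simp
  qed
  have a: "\<bar>x\<bar> * ?q powr (-4/3) \<le> 1" "x\<^sup>2 * ?q powr (-7/3) \<le> 1"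
  proof -
    have "\<bar>x\<bar> * ?q powr (-4/3) \<le> ?q * ?q powr (-1)" using x p by (intro mult_mono) auto
    then show "\<bar>x\<bar> * ?q powr (-4/3) \<le> 1" using m by (simp add: mult.commute)
    have "x\<^sup>2 * ?q powr (-7/3) \<le> ?q * ?q powr (-1)" using p by (intro mult_mono) auto
    then show "x\<^sup>2 * ?q powr (-7/3) \<le> 1" using m by (simp add: mult.commute)
  qed
  have "\<bar>far1 x\<bar> = 2/3 * (\<bar>x\<bar> * ?q powr (-4/3))" by (simp add: far1_def abs_mult)
  then show "\<bar>far1 x\<bar> \<le> 1" using a(1) by simp
  have "far2 x = - (2/3) * ?q powr (-4/3) + 16/9 * (x\<^sup>2 * ?q powr (-7/3))"
    by (simp add: far2_def)
  moreover have "0 \<le> ?q powr (-4/3)" "0 \<le> x\<^sup>2 * ?q powr (-7/3)" by auto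
  ultimately show "\<bar>far2 x\<bar> \<le> 3" using a(2) p(3) by argo
qed

text \<open>A solution with bounded second derivative that comes close to zero stays close to zero on one
side for a length of order \<open>sqrt \<delta>\<close> (in natural units), namely on the side towards which it
does not increase to first order. There the nonlinearity is of order \<open>\<delta>^(-3)\<close>, and so is the excess;
the energy would have to increase by an amount of order \<open>\<delta>^(-5/2)\<close>, more than its bound if
\<open>\<delta>\<close> is small. The constants come from the estimates above, which are uniform in \<open>\<delta>\<close>, so
\<open>\<delta>\<close> may be chosen last.\<close>

lemma no_touchdown:
  fixes a CE C :: real
  assumes CE: "CE > 0" and C: "C \<ge> 1"
  obtains \<delta> where "0 < \<delta>" "\<delta> \<le> 1"
    and "\<And>X E E' c. trunc_solution \<delta> a X \<Longrightarrow> (\<And>x. (E has_real_derivative E' x) (at x)) \<Longrightarrow>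
      (\<And>x. E' x \<ge> scl x ^ 24 * excess \<delta> (scl x ^ 12 * fst (X x)) / 8) \<Longrightarrow>
      E (c + 1) - E (c - 1) \<le> CE \<Longrightarrow>
      (\<And>x. \<bar>x - c\<bar> \<le> 1 \<Longrightarrow> \<bar>snd (snd (X x)) - far2 x\<bar> \<le> C * scl x ^ 19) \<Longrightarrow>
      \<delta> \<le> scl c ^ 12 * fst (X c)"
proof -
  \<comment> \<open>\<open>K\<close> bounds the second derivative in natural units, \<open>\<delta> * W\<close> the solution on the chosen side,
    and \<open>e\<close> is the square root of \<open>\<delta>\<close>, so small that the energy bound is violated\<close>
  define K W e where "K = 3 * (C + 3)" and "W = 3 * (1 + K)" and "e = 1 / (W ^ 3 * (48 * CE + 8))"
  have K: "K \<ge> 0" "W \<ge> 1" using C by (auto simp: K_def W_def)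
  have W3: "W ^ 3 \<ge> 1" using K by (simp add: one_le_power)
  have W8: "W ^ 3 * (48 * CE + 8) \<ge> 8"
  proof -
    have "1 * 8 \<le> W ^ 3 * (48 * CE + 8)" using W3 K CE by (intro mult_mono) auto
    then show ?thesis by simp
  qed
  then have e: "0 < e" "e \<le> 1/8" unfolding e_def by (auto simp: divide_le_eq)
  have eW: "1 / (e * W ^ 3) = 48 * CE + 8" using K W8 by (auto simp: e_def)
  define \<delta> where "\<delta> = e\<^sup>2"
  have \<delta>: "0 < \<delta>" "\<delta> \<le> 1" using e by (auto simp: \<delta>_def power_le_one)
  show thesis
  proof (rule that[OF \<delta>], rule ccontr)
    fix X E E' c
    assume X: "trunc_solution \<delta> a X" and E: "\<And>x. (E has_real_derivative E' x) (at x)"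
      and dens: "\<And>x. E' x \<ge> scl x ^ 24 * excess \<delta> (scl x ^ 12 * fst (X x)) / 8"
      and total: "E (c + 1) - E (c - 1) \<le> CE"
      and H2: "\<And>x. \<bar>x - c\<bar> \<le> 1 \<Longrightarrow> \<bar>snd (snd (X x)) - far2 x\<bar> \<le> C * scl x ^ 19"
      and "\<not> \<delta> \<le> scl c ^ 12 * fst (X c)"
    then have low: "scl c ^ 12 * fst (X c) < \<delta>" by simp
    define y where "y = scl c"
    have y1: "y \<ge> 1" unfolding y_def by (rule scl_ge_1)
    then have y0: "y > 0" by simp
    have E0: "E' x \<ge> 0" for x
      using dens[of x] excess_nonneg[OF \<delta>] scl_pos[of x]
      by (smt (verit) divide_nonneg_nonneg mult_nonneg_nonneg zero_less_power)
    have mono: "E s \<le> E t" if "s \<le> t" for s t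
      using DERIV_nonneg_imp_nondecreasing[OF that] E E0 by blast
    note D = trunc_solution_derivs[OF X]
    define H H1 H2' where "H x = fst (X x)" and "H1 x = fst (snd (X x))" and "H2' x = snd (snd (X x))" for x
    have H2b: "\<bar>H2' x\<bar> \<le> K * y ^ 20" if "\<bar>x - c\<bar> \<le> 1" for x
    proof -
      have "\<bar>H2' x\<bar> \<le> C * scl x ^ 19 + 3"
        using H2[OF that] far1_far2_bounds(2)[of x] by (simp add: H2'_def abs_le_iff)
      also have "\<dots> \<le> C * scl x ^ 20 + 3 * scl x ^ 20"
        using C scl_ge_1[of x] by (intro add_mono mult_left_mono power_increasing) (auto simp: one_le_power)
      also have "\<dots> = (C + 3) * scl x ^ 20" by (simp add: algebra_simps)
      also have "\<dots> \<le> (C + 3) * (3 * y ^ 20)"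
        unfolding y_def using C by (intro mult_left_mono scl_window that) auto
      also have "\<dots> = K * y ^ 20" by (simp only: K_def mult_ac)
      finally show ?thesis .
    qed
    \<comment> \<open>walk in the direction in which \<open>H\<close> does not increase to first order\<close>
    define \<epsilon> :: real where "\<epsilon> = (if H1 c \<le> 0 then 1 else -1)"
    have \<epsilon>: "\<bar>\<epsilon>\<bar> = 1" "\<epsilon> * \<epsilon> = 1" "\<epsilon> * H1 c \<le> 0" by (auto simp: \<epsilon>_def)
    define s where "s = e / y ^ 16"
    have s: "0 < s" "s \<le> 1"
      using e y0 one_le_power[OF y1, of 16] by (simp_all add: s_def divide_le_eq)
    have small: "H (c + \<epsilon> * t) \<le> \<delta> * (1 + K) / y ^ 12" if "0 < t" "t \<le> s" for t
    proof -
      define f where "f m = (if m = 0 then H else if m = 1 then H1 else H2')" for m :: nat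
      have "\<forall>m x. m < 2 \<and> c - 1 \<le> x \<and> x \<le> c + 1 \<longrightarrow> (f m has_real_derivative f (Suc m) x) (at x)"
        using D by (auto simp: f_def H_def[abs_def] H1_def[abs_def] H2'_def[abs_def])
      moreover have "f 0 = H" by (simp add: f_def)
      moreover have "c - 1 \<le> c" "c \<le> c + 1" "c - 1 \<le> c + \<epsilon> * t" "c + \<epsilon> * t \<le> c + 1" "c + \<epsilon> * t \<noteq> c"
        using that s by (auto simp: \<epsilon>_def)
      ultimately obtain z where z: "if c + \<epsilon> * t < c then c + \<epsilon> * t < z \<and> z < c else c < z \<and> z < c + \<epsilon> * t"
        and eq: "H (c + \<epsilon> * t) = (\<Sum>m<2. f m c / fact m * (c + \<epsilon> * t - c) ^ m)
           + f 2 z / fact 2 * (c + \<epsilon> * t - c)\<^sup>2"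
        using Taylor[of 2 f H "c - 1" "c + 1" c "c + \<epsilon> * t"] by auto
      have "H (c + \<epsilon> * t) = H c + (\<epsilon> * H1 c) * t + H2' z * t\<^sup>2 / 2"
        unfolding eq using \<epsilon>(2) by (simp add: f_def numeral_2_eq_2 algebra_simps)
      also have "\<dots> \<le> \<delta> / y ^ 12 + 0 + K * y ^ 20 * (\<delta> / y ^ 32)"
      proof (intro add_mono)
        show "H c \<le> \<delta> / y ^ 12" using low y0 by (simp add: H_def y_def le_divide_eq mult.commute)
        show "\<epsilon> * H1 c * t \<le> 0" using \<epsilon> that by (simp add: mult_nonpos_nonneg)
        have "\<bar>z - c\<bar> \<le> 1" using z that s \<epsilon>(1) by (auto simp: \<epsilon>_def split: if_splits)
        then have "H2' z \<le> K * y ^ 20" using H2b by (meson abs_le_D1)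
        moreover have "t\<^sup>2 \<le> s\<^sup>2" using that by (intro power_mono) auto
        moreover have "s\<^sup>2 = \<delta> / y ^ 32" by (simp add: s_def \<delta>_def power_divide flip: power_mult)
        moreover have "0 \<le> K * y ^ 20" using K y0 by simp
        ultimately have "H2' z * t\<^sup>2 \<le> K * y ^ 20 * (\<delta> / y ^ 32)"
          by (metis mult_mono zero_le_power2)
        moreover have "0 \<le> K * y ^ 20 * (\<delta> / y ^ 32)" using K \<delta> y0 by simp
        ultimately show "H2' z * t\<^sup>2 / 2 \<le> K * y ^ 20 * (\<delta> / y ^ 32)" by argo
      qed
      also have "K * y ^ 20 * (\<delta> / y ^ 32) = \<delta> * K / y ^ 12"
      proof -
        have "K * y ^ 20 * (\<delta> / y ^ 32) = \<delta> * K * (y ^ 20 / y ^ 32)" by simp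
        also have "y ^ 20 / y ^ 32 = 1 / y ^ 12" using y0 by (simp add: field_simps flip: power_add)
        finally show ?thesis by simp
      qed
      finally show ?thesis by (simp add: distrib_left add_divide_distrib)
    qed
    have exc: "excess \<delta> (scl (c + \<epsilon> * t) ^ 12 * H (c + \<epsilon> * t)) \<ge> (1 / (\<delta> * W) ^ 3 - 8) / 2"
      if "0 < t" "t \<le> s" for t
    proof -
      define x where "x = c + \<epsilon> * t"
      have near: "\<bar>x - c\<bar> \<le> 1" using that s \<epsilon> by (simp add: x_def abs_mult)
      have "scl x ^ 12 * H x \<le> \<delta> * W"
      proof (cases "H x \<le> 0")
        case True
        then have "scl x ^ 12 * H x \<le> 0" using scl_pos[of x] by (simp add: mult_nonneg_nonpos)
        then show ?thesis using \<delta> K by (smt (verit) mult_nonneg_nonneg)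
      next
        case False
        then have "scl x ^ 12 * H x \<le> 3 * y ^ 12 * H x"
          unfolding y_def by (intro mult_right_mono scl_window near) auto
        also have "\<dots> \<le> 3 * y ^ 12 * (\<delta> * (1 + K) / y ^ 12)"
          using small[OF that] y0 unfolding x_def by (intro mult_left_mono) auto
        also have "\<dots> = \<delta> * W" using y0 by (simp add: W_def)
        finally show ?thesis .
      qed
      then have "trunc_inv_cube \<delta> (\<delta> * W) \<le> trunc_inv_cube \<delta> (scl x ^ 12 * H x)"
        using trunc_inv_cube_diff(1)[OF \<delta>(1)] by simp
      moreover have "trunc_inv_cube \<delta> (\<delta> * W) = 1 / (\<delta> * W) ^ 3"
        using \<delta> K by (simp add: trunc_inv_cube_def)
      moreover have "trunc_inv_cube \<delta> (scl x ^ 12 * H x) \<le> 8 + 2 * excess \<delta> (scl x ^ 12 * H x)"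
        by (rule trunc_inv_cube_le_excess[OF \<delta>])
      ultimately show ?thesis unfolding x_def by argo
    qed
    have pos: "1 / (\<delta> * W) ^ 3 - 8 \<ge> 0" and big: "e * (1 / (\<delta> * W) ^ 3 - 8) > 48 * CE"
    proof -
      have "e * (e * W ^ 3) > 0" using e K by (intro mult_pos_pos zero_less_power) auto
      have "(\<delta> * W) ^ 3 = e ^ 4 * (e * (e * W ^ 3))"
        by (simp add: \<delta>_def power_mult_distrib eval_nat_numeral mult_ac)
      also have "\<dots> \<le> 1 * (e * (e * W ^ 3))"
        using e \<open>e * (e * W ^ 3) > 0\<close> by (intro mult_right_mono power_le_one) auto
      finally have "(\<delta> * W) ^ 3 \<le> e * (e * W ^ 3)" by simp
      then have "1 / (e * (e * W ^ 3)) \<le> 1 / (\<delta> * W) ^ 3"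
        using \<delta> K e by (intro divide_left_mono mult_pos_pos) (auto simp: \<open>e * (e * W ^ 3) > 0\<close>)
      moreover have "1 / (e * (e * W ^ 3)) = (48 * CE + 8) / e" unfolding eW[symmetric] by simp
      ultimately have "(48 * CE + 8) / e \<le> 1 / (\<delta> * W) ^ 3" by (simp only:)
      then have 1: "48 * CE + 8 \<le> e * (1 / (\<delta> * W) ^ 3)"
        using e by (simp only: pos_divide_le_eq mult.commute)
      have "e * (1 / (\<delta> * W) ^ 3 - 8) = e * (1 / (\<delta> * W) ^ 3) - 8 * e"
        by (simp add: right_diff_distrib)
      then show "e * (1 / (\<delta> * W) ^ 3 - 8) > 48 * CE" using 1 e by linarith
      then have "0 < e * (1 / (\<delta> * W) ^ 3 - 8)" using CE by linarith
      then show "1 / (\<delta> * W) ^ 3 - 8 \<ge> 0" using e by (simp add: zero_less_mult_iff)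
    qed
    obtain t where t: "0 < t" "t < s" and gain: "s * E' (c + \<epsilon> * t) \<le> CE"
    proof (cases "H1 c \<le> 0")
      case True
      obtain z where z: "c < z" "z < c + s" "E (c + s) - E c = (c + s - c) * E' z"
        using MVT2[of c "c + s" E E'] E s by auto
      have "E (c + s) - E c \<le> CE" using mono[of "c + s" "c + 1"] mono[of "c - 1" c] s total by auto
      then show thesis using that[of "z - c"] z True by (simp add: \<epsilon>_def)
    next
      case False
      obtain z where z: "c - s < z" "z < c" "E c - E (c - s) = (c - (c - s)) * E' z"
        using MVT2[of "c - s" c E E'] E s by auto
      have "E c - E (c - s) \<le> CE" using mono[of "c" "c + 1"] mono[of "c - 1" "c - s"] s total by auto
      then show thesis using that[of "c - z"] z False by (simp add: \<epsilon>_def)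
    qed
    define x where "x = c + \<epsilon> * t"
    have near: "\<bar>c - x\<bar> \<le> 1" using t s \<epsilon> by (simp add: x_def abs_mult)
    have "e * ((1 / (\<delta> * W) ^ 3 - 8) / 2) \<le> s * y ^ 24 * ((1 / (\<delta> * W) ^ 3 - 8) / 2)"
    proof (rule mult_right_mono)
      have "s * y ^ 24 = e * (y ^ 24 / y ^ 16)" by (simp add: s_def)
      also have "y ^ 24 / y ^ 16 = y ^ 8" using y0 by (simp add: field_simps flip: power_add)
      finally show "e \<le> s * y ^ 24" using e y1 one_le_power[OF y1, of 8] by (simp add: mult_left_le)
    qed (use pos in auto)
    also have "\<dots> \<le> s * (3 * scl x ^ 24) * excess \<delta> (scl x ^ 12 * H x)"
      unfolding y_def x_def
      by (intro mult_mono mult_left_mono exc scl_window)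
        (use t s pos near scl_pos in \<open>auto simp: x_def\<close>)
    also have "\<dots> = 24 * s * (scl x ^ 24 * excess \<delta> (scl x ^ 12 * H x) / 8)" by simp
    also have "\<dots> \<le> 24 * s * E' x"
      using dens[of x] s by (intro mult_left_mono) (auto simp: H_def)
    also have "\<dots> \<le> 24 * CE" using gain by (simp add: x_def)
    finally have "e * (1 / (\<delta> * W) ^ 3 - 8) \<le> 48 * CE"
      by (simp only: times_divide_eq_right) simp
    then show False using big by simp
  qed
qed

text \<open>The passage to the limit takes place in the space of initial values at \<open>0\<close> instead of a function space:
the bounds at a point are closed conditions on the initial value, by continuous dependence, and the
condition at \<open>0\<close> itself bounds it.\<close>

theorem entire_solution:
  fixes a :: real
  obtains H H1 H2 :: "real \<Rightarrow> real" and C :: real where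
    "\<And>x. (H has_real_derivative H1 x) (at x)" "\<And>x. (H1 has_real_derivative H2 x) (at x)"
    "\<And>x. (H2 has_real_derivative 1 / H x ^ 3 - (a + x\<^sup>2)) (at x)"
    "\<And>x. H x > 0"
    "\<And>x. \<bar>H x - far x\<bar> \<le> C / scl x ^ 13" "\<And>x. \<bar>H1 x - far1 x\<bar> \<le> C * scl x ^ 3"
    "\<And>x. \<bar>H2 x - far2 x\<bar> \<le> C * scl x ^ 19"
proof -
  obtain CE where CE: "CE > 0" and bvp: "\<And>\<delta> L. 0 < \<delta> \<Longrightarrow> \<delta> \<le> 1 \<Longrightarrow> 0 < L \<Longrightarrow>
      \<exists>X E E'. trunc_solution \<delta> a X \<and> (\<forall>x. (E has_real_derivative E' x) (at x))
        \<and> (\<forall>x. E' x \<ge> scl x ^ 24 * excess \<delta> (scl x ^ 12 * fst (X x)) / 8)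
        \<and> E L - E (- L) \<le> CE"
    using boundary_value_energy[of a] by metis
  define Near where "Near C c = {p :: real \<times> real \<times> real. \<bar>fst p - far c\<bar> \<le> C / scl c ^ 13
     \<and> \<bar>fst (snd p) - far1 c\<bar> \<le> C * scl c ^ 3 \<and> \<bar>snd (snd p) - far2 c\<bar> \<le> C * scl c ^ 19}" for C c
  obtain C where C: "C \<ge> 1" and win0: "\<And>\<delta> X E E' c. 0 < \<delta> \<Longrightarrow> \<delta> \<le> 1 \<Longrightarrow> trunc_solution \<delta> a X \<Longrightarrow>
      (\<And>x. (E has_real_derivative E' x) (at x)) \<Longrightarrow>
      (\<And>x. E' x \<ge> scl x ^ 24 * excess \<delta> (scl x ^ 12 * fst (X x)) / 8) \<Longrightarrow>
      E (c + 1) - E (c - 1) \<le> CE \<Longrightarrow>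
      \<bar>fst (X c) - far c\<bar> \<le> C / scl c ^ 13 \<and> \<bar>fst (snd (X c)) - far1 c\<bar> \<le> C * scl c ^ 3
        \<and> \<bar>snd (snd (X c)) - far2 c\<bar> \<le> C * scl c ^ 19"
    by (rule window_estimate[OF CE, of a]) blast
  obtain \<delta> where \<delta>: "0 < \<delta>" "\<delta> \<le> 1"
    and above: "\<And>X E E' c. trunc_solution \<delta> a X \<Longrightarrow> (\<And>x. (E has_real_derivative E' x) (at x)) \<Longrightarrow>
      (\<And>x. E' x \<ge> scl x ^ 24 * excess \<delta> (scl x ^ 12 * fst (X x)) / 8) \<Longrightarrow>
      E (c + 1) - E (c - 1) \<le> CE \<Longrightarrow>
      (\<And>x. \<bar>x - c\<bar> \<le> 1 \<Longrightarrow> \<bar>snd (snd (X x)) - far2 x\<bar> \<le> C * scl x ^ 19) \<Longrightarrow>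
      \<delta> \<le> scl c ^ 12 * fst (X c)"
    by (rule no_touchdown[OF CE C, of a]) blast
  define Good where "Good c = Near C c \<inter> {p. \<delta> \<le> scl c ^ 12 * fst p}" for c
  have "\<exists>X. trunc_solution \<delta> a X \<and> X 0 = p" for p
    using trunc_solution_exists[OF \<delta>(1)] by metis
  then obtain F where F: "\<And>p. trunc_solution \<delta> a (F p)" "\<And>p. F p 0 = p" by metis
  have lip: "\<exists>k. \<forall>X Y. trunc_solution \<delta> a X \<longrightarrow> trunc_solution \<delta> a Y \<longrightarrow>
      norm (X x - Y x) \<le> k * norm (X 0 - Y 0)" for x
    using trunc_solutions_close[OF \<delta>(1), of a x 0] by metis
  have contF: "continuous_on UNIV (\<lambda>p. F p x)" for x
  proof -
    obtain k where k: "\<And>X Y. trunc_solution \<delta> a X \<Longrightarrow> trunc_solution \<delta> a Y \<Longrightarrow>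
      norm (X x - Y x) \<le> k * norm (X 0 - Y 0)" using lip by blast
    have "norm (F p x - F q x) \<le> \<bar>k\<bar> * norm (p - q)" for p q
      using order_trans[OF k[OF F(1) F(1), of p q] mult_right_mono[OF abs_ge_self]] by (simp add: F(2))
    then show ?thesis
      by (intro lipschitz_on_continuous_on[of "\<bar>k\<bar>"] lipschitz_onI) (auto simp: dist_norm)
  qed
  have closed_Good: "closed (Good c)" for c
    unfolding Good_def Near_def
    by (intro closed_Int closed_Collect_conj closed_Collect_le continuous_intros)
  \<comment> \<open>\<open>scl 0 = 1\<close>, so the bounds at \<open>0\<close> confine all three components\<close>
  have bounded_Good: "bounded (Good 0)"
  proof (rule boundedI)
    fix p assume "p \<in> Good 0"
    then have "\<bar>fst p\<bar> \<le> C + \<bar>far 0\<bar>" "\<bar>fst (snd p)\<bar> \<le> C + \<bar>far1 0\<bar>" "\<bar>snd (snd p)\<bar> \<le> C + \<bar>far2 0\<bar>"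
      by (auto simp: Good_def Near_def scl_def abs_le_iff)
    moreover have "norm p \<le> \<bar>fst p\<bar> + (\<bar>fst (snd p)\<bar> + \<bar>snd (snd p)\<bar>)"
      using norm_Pair_le[of "fst p" "snd p"] norm_Pair_le[of "fst (snd p)" "snd (snd p)"]
      by (smt (verit) prod.collapse real_norm_def)
    ultimately show "norm p \<le> (C + \<bar>far 0\<bar>) + ((C + \<bar>far1 0\<bar>) + (C + \<bar>far2 0\<bar>))" by linarith
  qed
  define K where "K n = (\<Inter>c\<in>{- real n..real n}. (\<lambda>p. F p c) -` Good c)" for n
  have "\<Inter>(range K) \<noteq> {}"
  proof (rule compact_nest)
    show "compact (K n)" for n
    proof -
      have "closed (K n)"
        unfolding K_def by (intro closed_INT ballI closed_vimage closed_Good contF)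
      moreover have "K n \<subseteq> Good 0"
      proof
        fix p assume "p \<in> K n"
        then have "F p 0 \<in> Good 0" by (simp add: K_def)
        then show "p \<in> Good 0" by (simp only: F(2))
      qed
      ultimately show ?thesis
        using bounded_Good bounded_subset compact_eq_bounded_closed by blast
    qed
    show "K n \<subseteq> K m" if "m \<le> n" for m n
      using that unfolding K_def by (intro INF_superset_mono) auto
    show "K n \<noteq> {}" for n
    proof -
      \<comment> \<open>one unit of margin for the window of \<open>window_estimate\<close>, another one because
        \<open>no_touchdown\<close> needs the second derivative on a whole window\<close>
      obtain X E E' where X: "trunc_solution \<delta> a X" and E: "\<And>x. (E has_real_derivative E' x) (at x)"
        and dens: "\<And>x. E' x \<ge> scl x ^ 24 * excess \<delta> (scl x ^ 12 * fst (X x)) / 8"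
        and EL: "E (real n + 2) - E (- (real n + 2)) \<le> CE"
        using bvp[OF \<delta>, of "real n + 2"] by auto
      have E0: "E' x \<ge> 0" for x
        using dens[of x] excess_nonneg[OF \<delta>] scl_pos[of x]
        by (smt (verit) divide_nonneg_nonneg mult_nonneg_nonneg zero_less_power)
      have mono: "E s \<le> E t" if "s \<le> t" for s t
        using DERIV_nonneg_imp_nondecreasing[OF that] E E0 by blast
      have total: "E (c + 1) - E (c - 1) \<le> CE" if "\<bar>c\<bar> \<le> real n + 1" for c
        using mono[of "c + 1" "real n + 2"] mono[of "- (real n + 2)" "c - 1"] that EL by (simp add: abs_le_iff)
      have near: "X c \<in> Near C c" if "\<bar>c\<bar> \<le> real n + 1" for c
        unfolding Near_def mem_Collect_eq by (rule win0[OF \<delta> X E dens total[OF that]])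
      have "X c \<in> Good c" if "c \<in> {- real n..real n}" for c
      proof -
        have "\<delta> \<le> scl c ^ 12 * fst (X c)"
        proof (rule above[OF X E dens total])
          show "\<bar>c\<bar> \<le> real n + 1" using that by auto
          show "\<bar>snd (snd (X x)) - far2 x\<bar> \<le> C * scl x ^ 19" if "\<bar>x - c\<bar> \<le> 1" for x
            using near[of x] that \<open>c \<in> _\<close> by (auto simp: Near_def abs_le_iff)
        qed
        then show ?thesis using near[of c] that by (auto simp: Good_def)
      qed
      moreover have "F (X 0) c = X c" for c
      proof -
        obtain k where "norm (F (X 0) c - X c) \<le> k * norm (F (X 0) 0 - X 0)"
          using lip[of c] F(1) X by metis
        then show ?thesis by (simp add: F(2))
      qed
      ultimately have "X 0 \<in> K n" by (simp add: K_def)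
      then show ?thesis by blast
    qed
  qed
  then obtain p where p: "\<And>n. p \<in> K n" by blast
  have good: "F p c \<in> Good c" for c
  proof -
    obtain n where "\<bar>c\<bar> \<le> real n" using real_arch_simple by blast
    then have "c \<in> {- real n..real n}" by (simp add: abs_le_iff)
    then show ?thesis using p[of n] by (auto simp: K_def)
  qed
  note D = trunc_solution_derivs[OF F(1)[of p]]
  have lowb: "\<delta> \<le> scl x ^ 12 * fst (F p x)" for x using good[of x] by (simp add: Good_def)
  show thesis
  proof (rule that[of "\<lambda>x. fst (F p x)" "\<lambda>x. fst (snd (F p x))" "\<lambda>x. snd (snd (F p x))" C])
    show pos: "fst (F p x) > 0" for x
      using lowb[of x] \<delta> scl_pos[of x] by (smt (verit) mult_nonneg_nonpos zero_less_power)
    have "third_rhs \<delta> a x (fst (F p x)) = 1 / fst (F p x) ^ 3 - (a + x\<^sup>2)" for x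
      using lowb[of x] scl_pos[of x]
      by (simp add: third_rhs_def trunc_inv_cube_def power_mult_distrib flip: power_mult)
    then show "((\<lambda>x. snd (snd (F p x))) has_real_derivative 1 / fst (F p x) ^ 3 - (a + x\<^sup>2)) (at x)" for x
      using D(3)[of x] by simp
  qed (use D good in \<open>auto simp: Good_def Near_def\<close>)
qed


section \<open>Back to the autonomous system\<close>

text \<open>Powers of \<open>1 + x^2\<close> with exponents in ninths. Indexing them by integers lets the simplifier add
exponents, which reduces the change of variables to linear algebra in these powers.\<close>

definition ninth :: "int \<Rightarrow> real \<Rightarrow> real" where
  "ninth k x = (1 + x\<^sup>2) powr (real_of_int k / 9)"

lemma ninth_pos: "ninth k x > 0"
  using one_plus_sq_pos[of x] by (simp add: ninth_def)

lemma ninth_mult: "ninth j x * ninth k x = ninth (j + k) x"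
  by (simp add: ninth_def add_divide_distrib powr_add)

lemma ninth_mult_left: "ninth j x * (ninth k x * c) = ninth (j + k) x * c"
  by (simp add: mult.assoc[symmetric] ninth_mult)

lemma ninth_mult_numeral: "ninth j x * (numeral n * ninth k x) = numeral n * ninth (j + k) x"
  by (simp add: mult.left_commute ninth_mult)

lemma ninth_9: "ninth 9 x = 1 + x\<^sup>2"
  using one_plus_sq_pos[of x] by (simp add: ninth_def)

lemma ninth_deriv: "(ninth k has_real_derivative 2 * real_of_int k / 9 * x * ninth (k - 9) x) (at x)"
  unfolding ninth_def[abs_def]
  by (rule DERIV_cong[OF one_plus_sq_powr_deriv]) (simp add: diff_divide_distrib)

lemma ninth_scl: "ninth (int n) x = scl x ^ (4 * n)"
  by (simp add: ninth_def scl_power)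

lemma ninth_neg_scl: "ninth (- int n) x = 1 / scl x ^ (4 * n)"
  using one_plus_sq_pos[of x] by (simp add: ninth_def scl_power powr_minus_divide)

lemma cos_arctan_powr: "cos (arctan x) powr r = (1 + x\<^sup>2) powr (- r / 2)"
proof -
  have "cos (arctan x) = (1 + x\<^sup>2) powr (-1/2)"
    using one_plus_sq_pos[of x] by (simp add: cos_arctan powr_minus_divide powr_half_sqrt)
  then show ?thesis by (simp add: powr_powr)
qed

lemma sin_cos_arctan: "sin (arctan x) = x * cos (arctan x)"
  by (simp add: sin_arctan cos_arctan)

text \<open>The curve in phase space that belongs to \<open>H\<close>: the second and third components are the first and second
derivatives of \<open>\<Phi>\<close> with respect to \<open>\<tau>\<close>, where \<open>d/d\<tau> = ninth (-4) x * d/dx\<close>.\<close>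

definition phase_point :: "(real \<Rightarrow> real) \<Rightarrow> (real \<Rightarrow> real) \<Rightarrow> (real \<Rightarrow> real) \<Rightarrow> real \<Rightarrow> state" where
  "phase_point H H1 H2 x =
    (ninth 3 x * H x,
     ninth (-1) x * H1 x + 2/3 * x * ninth (-10) x * H x,
     ninth (-5) x * H2 x + 4/9 * x * ninth (-14) x * H1 x
       + (2/3 * ninth (-14) x - 40/27 * x\<^sup>2 * ninth (-23) x) * H x,
     arctan x)"

text \<open>The factor \<open>ninth 4 x\<close> is \<open>d\<tau>/dx\<close>. In the third component, substituting \<open>H'''\<close> and
expressing the lower-order terms through \<open>\<Phi>\<close>, \<open>W\<close> and \<open>\<Psi>\<close> produces exactly the coefficients of
the vector field.\<close>

lemma phase_point_deriv:
  assumes H: "\<And>x. (H has_real_derivative H1 x) (at x)" "\<And>x. (H1 has_real_derivative H2 x) (at x)"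
    "\<And>x. (H2 has_real_derivative 1 / H x ^ 3 - (a + x\<^sup>2)) (at x)"
    and pos: "H x > 0"
  shows "(phase_point H H1 H2 has_vector_derivative
    ninth 4 x *\<^sub>R vector_field a (phase_point H H1 H2 x)) (at x)"
proof -
  define \<Phi> W \<Psi> where "\<Phi> x = ninth 3 x * H x"
    and "W x = ninth (-1) x * H1 x + 2/3 * x * ninth (-10) x * H x"
    and "\<Psi> x = ninth (-5) x * H2 x + 4/9 * x * ninth (-14) x * H1 x
       + (2/3 * ninth (-14) x - 40/27 * x\<^sup>2 * ninth (-23) x) * H x" for x
  define c where "c = cos (arctan x)"
  have s: "sin (arctan x) = x * c" by (simp add: sin_cos_arctan c_def)
  have cp: "c powr r = (1 + x\<^sup>2) powr (- r / 2)" for r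
    unfolding c_def by (rule cos_arctan_powr)
  have c0: "c > 0" unfolding c_def using one_plus_sq_pos[of x] by (simp add: cos_arctan)
  have c_nat: "c ^ n * c powr r = (1 + x\<^sup>2) powr (- (real n + r) / 2)" for n r
    using c0 cp[of "real n + r"] by (simp add: powr_add powr_realpow)
  have Z: "1 / \<Phi> x ^ 3 - 1 - (a - 1) * c ^ 2
        - ((16 / 3 * (x * c) - 224 / 27 * (x * c) ^ 3) * (c powr (17 / 3)) * \<Phi> x
           + (208 / 81 * (x * c) ^ 2 - 10 / 9) * (c powr (34 / 9)) * W x
           + 2 / 3 * (x * c) * (c powr (17 / 9)) * \<Psi> x)
     = ninth (-9) x * (1 / H x ^ 3 - (a + x\<^sup>2))
        - ((16 / 3 * x * ninth (-30) x - 224 / 27 * x ^ 3 * ninth (-39) x) * \<Phi> x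
           + (208 / 81 * x\<^sup>2 * ninth (-26) x - 10 / 9 * ninth (-17) x) * W x
           + 2 / 3 * x * ninth (-13) x * \<Psi> x)"
  proof -
    have "c * c powr (17/3) = ninth (-30) x" "c ^ 3 * c powr (17/3) = ninth (-39) x"
      "c\<^sup>2 * c powr (34/9) = ninth (-26) x" "c powr (34/9) = ninth (-17) x"
      "c * c powr (17/9) = ninth (-13) x"
      using c_nat[of 1 "17/3"] c_nat[of 3 "17/3"] c_nat[of 2 "34/9"] c_nat[of 0 "34/9"] c_nat[of 1 "17/9"]
      by (simp_all add: ninth_def)
    moreover have "1 / \<Phi> x ^ 3 - 1 - (a - 1) * c ^ 2 = ninth (-9) x * (1 / H x ^ 3 - (a + x\<^sup>2))"
    proof -
      have i: "ninth (-9) x = 1 / (1 + x\<^sup>2)"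
        using one_plus_sq_pos[of x] by (simp add: ninth_def powr_minus_divide)
      have c2: "c\<^sup>2 = 1 / (1 + x\<^sup>2)"
        using one_plus_sq_pos[of x] by (simp add: c_def cos_arctan power_divide)
      have "ninth 3 x ^ 3 = 1 + x\<^sup>2"
        by (simp add: power3_eq_cube ninth_mult ninth_9)
      then have "\<Phi> x ^ 3 = (1 + x\<^sup>2) * H x ^ 3" by (simp add: \<Phi>_def power_mult_distrib)
      then have "1 / \<Phi> x ^ 3 = 1 / (1 + x\<^sup>2) * (1 / H x ^ 3)" by simp
      moreover have "1 + (a - 1) * (1 / (1 + x\<^sup>2)) = 1 / (1 + x\<^sup>2) * (a + x\<^sup>2)"
        using one_plus_sq_pos[of x] by (simp add: field_simps)
      ultimately show ?thesis unfolding i c2 by (simp add: right_diff_distrib)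
    qed
    moreover have "(16 / 3 * (x * c) - 224 / 27 * (x * c) ^ 3) * (c powr (17 / 3))
       = 16/3 * x * (c * c powr (17/3)) - 224/27 * x ^ 3 * (c ^ 3 * c powr (17/3))"
      "(208 / 81 * (x * c) ^ 2 - 10 / 9) * (c powr (34 / 9))
       = 208/81 * x\<^sup>2 * (c\<^sup>2 * c powr (34/9)) - 10/9 * c powr (34/9)"
      "2 / 3 * (x * c) * (c powr (17 / 9)) = 2/3 * x * (c * c powr (17/9))"
      by (simp_all add: algebra_simps power_mult_distrib)
    ultimately show ?thesis by simp
  qed
  have "(\<Phi> has_real_derivative ninth 4 x * W x) (at x)"
    unfolding \<Phi>_def[abs_def] W_def
    by (rule ninth_deriv H derivative_eq_intros refl)+
      (simp add: algebra_simps ninth_mult ninth_mult_left ninth_mult_numeral)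
  moreover have "(W has_real_derivative ninth 4 x * \<Psi> x) (at x)"
    unfolding W_def[abs_def] \<Psi>_def
    by (rule ninth_deriv H derivative_eq_intros refl)+
      (simp add: algebra_simps ninth_mult ninth_mult_left ninth_mult_numeral power2_eq_square)
  moreover have "(\<Psi> has_real_derivative ninth 4 x * (ninth (-9) x * (1 / H x ^ 3 - (a + x\<^sup>2))
        - ((16 / 3 * x * ninth (-30) x - 224 / 27 * x ^ 3 * ninth (-39) x) * \<Phi> x
           + (208 / 81 * x\<^sup>2 * ninth (-26) x - 10 / 9 * ninth (-17) x) * W x
           + 2 / 3 * x * ninth (-13) x * \<Psi> x))) (at x)"
  proof -
    define R where "R = 1 / H x ^ 3 - (a + x\<^sup>2)"
    have R: "(H2 has_real_derivative R) (at x)" unfolding R_def by (rule H)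
    show ?thesis
      unfolding R_def[symmetric] unfolding W_def \<Psi>_def[abs_def] \<Phi>_def
      by ((rule ninth_deriv R H(1,2) derivative_eq_intros refl)+,
        simp add: algebra_simps ninth_mult ninth_mult_left ninth_mult_numeral power2_eq_square power3_eq_cube,
        simp add: field_simps)
  qed
  moreover have "(arctan has_real_derivative ninth 4 x * c powr (26/9)) (at x)"
  proof (rule DERIV_cong[OF DERIV_arctan])
    have "c powr (26/9) = ninth (-13) x" unfolding cp by (simp add: ninth_def)
    moreover have "ninth (-9) x = inverse (1 + x\<^sup>2)"
      using one_plus_sq_pos[of x] by (simp add: ninth_def powr_minus)
    ultimately show "inverse (1 + x\<^sup>2) = ninth 4 x * c powr (26/9)" by (simp add: ninth_mult)
  qed
  ultimately have "((\<lambda>x. (\<Phi> x, W x, \<Psi> x, arctan x)) has_vector_derivative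
      (ninth 4 x * W x, ninth 4 x * \<Psi> x,
       ninth 4 x * (ninth (-9) x * (1 / H x ^ 3 - (a + x\<^sup>2))
        - ((16 / 3 * x * ninth (-30) x - 224 / 27 * x ^ 3 * ninth (-39) x) * \<Phi> x
           + (208 / 81 * x\<^sup>2 * ninth (-26) x - 10 / 9 * ninth (-17) x) * W x
           + 2 / 3 * x * ninth (-13) x * \<Psi> x)), ninth 4 x * c powr (26/9))) (at x)"
    unfolding has_real_derivative_iff_has_vector_derivative
    by (intro has_vector_derivative_Pair)
  then show ?thesis
    unfolding phase_point_def[abs_def] \<Phi>_def[symmetric] W_def[symmetric] \<Psi>_def[symmetric]
    unfolding vector_field_def prod.case s c_def[symmetric] Z[symmetric] by simp
qed

lemma phase_point_asymptotics:
  assumes H: "\<And>x. \<bar>H x - far x\<bar> \<le> C / scl x ^ 13" "\<And>x. \<bar>H1 x - far1 x\<bar> \<le> C * scl x ^ 3"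
    "\<And>x. \<bar>H2 x - far2 x\<bar> \<le> C * scl x ^ 19"
  obtains D where "\<And>x. \<bar>fst (phase_point H H1 H2 x) - 1\<bar> \<le> D / scl x"
    "\<And>x. \<bar>fst (snd (phase_point H H1 H2 x))\<bar> \<le> D / scl x"
    "\<And>x. \<bar>fst (snd (snd (phase_point H H1 H2 x)))\<bar> \<le> D / scl x"
proof -
  have C: "C \<ge> 0" using H(1)[of 0] by (auto simp: scl_def)
  define D where "D = 5 * C + 10"
  have b: "\<bar>fst (phase_point H H1 H2 x) - 1\<bar> \<le> C / scl x \<and>
    \<bar>fst (snd (phase_point H H1 H2 x))\<bar> \<le> D / scl x \<and>
    \<bar>fst (snd (snd (phase_point H H1 H2 x)))\<bar> \<le> D / scl x" for x
  proof -
    define y where "y = scl x"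
    have y1: "y \<ge> 1" unfolding y_def by (rule scl_ge_1)
    then have y0: "y > 0" by simp
    have n3: "ninth 3 x = y ^ 12" using ninth_scl[of 3 x] by (simp add: y_def)
    have nn: "ninth (-1) x = 1 / y ^ 4" "ninth (-10) x = 1 / y ^ 40" "ninth (-5) x = 1 / y ^ 20"
      "ninth (-14) x = 1 / y ^ 56" "ninth (-23) x = 1 / y ^ 92"
      using ninth_neg_scl[of 1 x] ninth_neg_scl[of 10 x] ninth_neg_scl[of 5 x] ninth_neg_scl[of 14 x]
        ninth_neg_scl[of 23 x] by (simp_all add: y_def)
    have x2: "x\<^sup>2 \<le> y ^ 36" using scl_power_36[of x] by (simp add: y_def)
    have x1: "\<bar>x\<bar> \<le> y ^ 18"
    proof (rule power2_le_imp_le)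
      show "\<bar>x\<bar>\<^sup>2 \<le> (y ^ 18)\<^sup>2" using x2 by (simp flip: power_mult)
    qed (use y0 in simp)
    have inv: "t / y ^ n \<le> t / y ^ m" if "m \<le> n" "t \<ge> 0" for t m n
      using that y1 by (intro divide_left_mono power_increasing) auto
    have 1: "\<bar>y ^ 12 * H x - 1\<bar> \<le> C / y"
    proof -
      have "y ^ 12 * H x - 1 = y ^ 12 * (H x - far x)"
        using y0 by (simp add: far_eq y_def[symmetric] right_diff_distrib)
      then have "\<bar>y ^ 12 * H x - 1\<bar> = y ^ 12 * \<bar>H x - far x\<bar>" using y0 by (simp add: abs_mult)
      also have "\<dots> \<le> y ^ 12 * (C / y ^ 13)" using H(1)[of x] y0 by (intro mult_left_mono) (auto simp: y_def)
      also have "\<dots> = C / y" using y0 by (simp add: eval_nat_numeral)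
      finally show ?thesis .
    qed
    have h0: "\<bar>H x\<bar> \<le> C + 1"
    proof -
      have "\<bar>far x\<bar> \<le> 1" using scl_ge_1[of x] by (simp add: far_eq one_le_power)
      moreover have "\<bar>H x - far x\<bar> \<le> C / y ^ 0" using H(1)[of x] inv[of 0 13 C] C by (simp add: y_def)
      ultimately show ?thesis by simp
    qed
    have h1: "\<bar>H1 x\<bar> \<le> (C + 1) * y ^ 3"
      using H(2)[of x] far1_far2_bounds(1)[of x] one_le_power[OF y1, of 3]
      unfolding y_def distrib_right by argo
    have h2: "\<bar>H2 x\<bar> \<le> (C + 3) * y ^ 19"
      using H(3)[of x] far1_far2_bounds(2)[of x] one_le_power[OF y1, of 19]
      unfolding y_def distrib_right by argo
    have quot: "\<bar>p\<bar> / y ^ n \<le> t / y" if "\<bar>p\<bar> \<le> t * y ^ m" "m < n" "t \<ge> 0" for p t m n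
    proof -
      have "\<bar>p\<bar> / y ^ n \<le> t * y ^ m / y ^ n" using that y0 by (intro divide_right_mono) auto
      also have "\<dots> \<le> t * y ^ m / y ^ Suc m" using that y1 by (intro divide_left_mono power_increasing) auto
      also have "\<dots> = t / y" using y0 by simp
      finally show ?thesis .
    qed
    have 2: "\<bar>ninth (-1) x * H1 x + 2/3 * x * ninth (-10) x * H x\<bar> \<le> D / y"
    proof -
      have "\<bar>ninth (-1) x * H1 x\<bar> \<le> (C + 1) / y"
        unfolding nn using quot[OF h1, of 4] C y0 by (simp add: abs_mult)
      moreover have "\<bar>2/3 * x * ninth (-10) x * H x\<bar> \<le> (C + 1) / y"
      proof -
        have "\<bar>2/3 * x * H x\<bar> \<le> (C + 1) * y ^ 18"
        proof -
          have "\<bar>x\<bar> * \<bar>H x\<bar> \<le> y ^ 18 * (C + 1)" using x1 h0 y0 by (intro mult_mono) auto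
          moreover have "0 \<le> \<bar>x\<bar> * \<bar>H x\<bar>" by simp
          moreover have "\<bar>2/3 * x * H x\<bar> = 2/3 * (\<bar>x\<bar> * \<bar>H x\<bar>)" by (simp add: abs_mult)
          ultimately show ?thesis unfolding mult.commute[of "C + 1"] by argo
        qed
        from quot[OF this, of 40] show ?thesis unfolding nn using C y0 by (simp add: abs_mult)
      qed
      moreover have "(C + 1) / y + (C + 1) / y \<le> D / y"
        unfolding add_divide_distrib[symmetric] using C y0 by (intro divide_right_mono) (auto simp: D_def)
      ultimately show ?thesis by linarith
    qed
    have 3: "\<bar>ninth (-5) x * H2 x + 4/9 * x * ninth (-14) x * H1 x
       + (2/3 * ninth (-14) x - 40/27 * x\<^sup>2 * ninth (-23) x) * H x\<bar> \<le> D / y"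
    proof -
      have "\<bar>ninth (-5) x * H2 x\<bar> \<le> (C + 3) / y"
        unfolding nn using quot[OF h2, of 20] C y0 by (simp add: abs_mult)
      moreover have "\<bar>4/9 * x * ninth (-14) x * H1 x\<bar> \<le> (C + 1) / y"
      proof -
        have "\<bar>4/9 * x * H1 x\<bar> \<le> (C + 1) * y ^ 21"
        proof -
          have "\<bar>x\<bar> * \<bar>H1 x\<bar> \<le> y ^ 18 * ((C + 1) * y ^ 3)" using x1 h1 y0 by (intro mult_mono) auto
          also have "\<dots> = (C + 1) * y ^ 21" by (simp flip: power_add)
          finally have "\<bar>x\<bar> * \<bar>H1 x\<bar> \<le> (C + 1) * y ^ 21" .
          moreover have "0 \<le> \<bar>x\<bar> * \<bar>H1 x\<bar>" by simp
          moreover have "\<bar>4/9 * x * H1 x\<bar> = 4/9 * (\<bar>x\<bar> * \<bar>H1 x\<bar>)" by (simp add: abs_mult)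
          ultimately show ?thesis by argo
        qed
        from quot[OF this, of 56] show ?thesis unfolding nn using C y0 by (simp add: abs_mult)
      qed
      moreover have "\<bar>2/3 * ninth (-14) x * H x\<bar> \<le> (C + 1) / y"
      proof -
        have "\<bar>2/3 * H x\<bar> \<le> (C + 1) * y ^ 0" using h0 C by (simp add: abs_mult)
        from quot[OF this, of 56] show ?thesis unfolding nn using C y0 by (simp add: abs_mult)
      qed
      moreover have "\<bar>40/27 * x\<^sup>2 * ninth (-23) x * H x\<bar> \<le> 2 * (C + 1) / y"
      proof -
        have "\<bar>40/27 * x\<^sup>2 * H x\<bar> \<le> 2 * (C + 1) * y ^ 36"
        proof -
          have "x\<^sup>2 * \<bar>H x\<bar> \<le> y ^ 36 * (C + 1)" using x2 h0 y0 by (intro mult_mono) auto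
          moreover have "0 \<le> x\<^sup>2 * \<bar>H x\<bar>" by simp
          moreover have "\<bar>40/27 * x\<^sup>2 * H x\<bar> = 40/27 * (x\<^sup>2 * \<bar>H x\<bar>)" by (simp add: abs_mult)
          moreover have "2 * (C + 1) * y ^ 36 = 2 * (y ^ 36 * (C + 1))" by simp
          ultimately show ?thesis by argo
        qed
        from quot[OF this, of 92] show ?thesis unfolding nn using C y0 by (simp add: abs_mult)
      qed
      moreover have "(C + 3) / y + (C + 1) / y + (C + 1) / y + 2 * (C + 1) / y \<le> D / y"
        unfolding add_divide_distrib[symmetric] using C y0 by (intro divide_right_mono) (auto simp: D_def)
      ultimately show ?thesis unfolding left_diff_distrib by linarith
    qed
    show ?thesis using 1 2 3 by (simp add: phase_point_def n3 y_def)
  qed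
  have "C / scl x \<le> D / scl x" for x
    using scl_pos[of x] C by (intro divide_right_mono) (auto simp: D_def)
  then show thesis using that[of D] b order_trans by blast
qed

text \<open>The new time grows at least as fast as \<open>\<bar>x\<bar>\<close>, so its inverse is defined on the whole line.\<close>

lemma time_change:
  obtains \<xi> :: "real \<Rightarrow> real" where
    "\<And>t. (\<xi> has_real_derivative 1 / ninth 4 (\<xi> t)) (at t)"
    "filterlim \<xi> at_top at_top" "filterlim \<xi> at_bot at_bot"
proof -
  have c4: "continuous_on UNIV (ninth 4)"
    by (meson ninth_deriv DERIV_isCont continuous_at_imp_continuous_on)
  obtain T where T0: "T 0 = (0::real)" and "\<And>x. (T has_vector_derivative ninth 4 x) (at x)"
    using antiderivative_on_line[OF c4] by metis
  then have T: "(T has_real_derivative ninth 4 x) (at x)" for x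
    by (simp add: has_real_derivative_iff_has_vector_derivative)
  have n1: "ninth 4 x \<ge> 1" for x
    using ninth_scl[of 4 x] scl_ge_1[of x] by (simp add: one_le_power)
  have mono: "T x < T z" if "x < z" for x z
    using DERIV_pos_imp_increasing[OF that] T ninth_pos by blast
  have grow: "T z - T x \<ge> z - x" if "x \<le> z" for x z
  proof -
    have "T x - x \<le> T z - z"
    proof (rule DERIV_nonneg_imp_nondecreasing[OF that])
      fix s
      have "((\<lambda>x. T x - x) has_real_derivative ninth 4 s - 1) (at s)"
        by (rule derivative_eq_intros T refl)+
      then show "\<exists>d. ((\<lambda>x. T x - x) has_real_derivative d) (at s) \<and> 0 \<le> d"
        using n1[of s] by fastforce
    qed
    then show ?thesis by simp
  qed
  have cT: "isCont T x" for x using T by (rule DERIV_isCont)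
  have "\<exists>x. T x = t" for t
  proof -
    have "T (- \<bar>t\<bar>) \<le> t" "t \<le> T \<bar>t\<bar>" using grow[of "- \<bar>t\<bar>" 0] grow[of 0 "\<bar>t\<bar>"] T0 by auto
    then show ?thesis
      using IVT'[of T "- \<bar>t\<bar>" t "\<bar>t\<bar>"] cT continuous_at_imp_continuous_on[of _ T] by auto
  qed
  then obtain \<xi> where \<xi>: "\<And>t. T (\<xi> t) = t" by metis
  have \<xi>T: "\<xi> (T x) = x" for x
    using mono[of "\<xi> (T x)" x] mono[of x "\<xi> (T x)"] \<xi>[of "T x"] by (cases x "\<xi> (T x)" rule: linorder_cases) auto
  have c\<xi>: "isCont \<xi> t" for t
    using isCont_inverse_function[of 1 "\<xi> t" \<xi> T] \<xi>T cT by (simp add: \<xi>)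
  show thesis
  proof (rule that[of \<xi>])
    show "(\<xi> has_real_derivative 1 / ninth 4 (\<xi> t)) (at t)" for t
      using DERIV_inverse_function[of T "ninth 4 (\<xi> t)" \<xi> t "t - 1" "t + 1"] T \<xi> c\<xi> ninth_pos[of 4 "\<xi> t"]
      by (simp add: inverse_eq_divide)
    have \<xi>mono: "\<xi> s \<le> \<xi> t" if "s \<le> t" for s t
      using mono[of "\<xi> t" "\<xi> s"] \<xi> that by (metis linorder_not_le)
    show "filterlim \<xi> at_top at_top"
      unfolding filterlim_at_top eventually_at_top_linorder
      using \<xi>mono \<xi>T by metis
    show "filterlim \<xi> at_bot at_bot"
      unfolding filterlim_at_bot eventually_at_bot_linorder
      using \<xi>mono \<xi>T by metis
  qed
qed

theorem theorem2p3:
  fixes a :: real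
  shows "\<exists>x. heteroclinic_connection a x p_minus p_plus"
proof -
  obtain H H1 H2 :: "real \<Rightarrow> real" and C where
    D: "\<And>x. (H has_real_derivative H1 x) (at x)" "\<And>x. (H1 has_real_derivative H2 x) (at x)"
      "\<And>x. (H2 has_real_derivative 1 / H x ^ 3 - (a + x\<^sup>2)) (at x)"
    and pos: "\<And>x. H x > 0"
    and near: "\<And>x. \<bar>H x - far x\<bar> \<le> C / scl x ^ 13" "\<And>x. \<bar>H1 x - far1 x\<bar> \<le> C * scl x ^ 3"
      "\<And>x. \<bar>H2 x - far2 x\<bar> \<le> C * scl x ^ 19"
    using entire_solution[of a] by metis
  obtain \<xi> where \<xi>: "\<And>t. (\<xi> has_real_derivative 1 / ninth 4 (\<xi> t)) (at t)"
    and lim: "filterlim \<xi> at_top at_top" "filterlim \<xi> at_bot at_bot"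
    using time_change by blast
  let ?P = "phase_point H H1 H2"
  have "(?P \<circ> \<xi> has_vector_derivative vector_field a (?P (\<xi> t))) (at t)" for t
  proof -
    have "(?P \<circ> \<xi> has_vector_derivative
        (1 / ninth 4 (\<xi> t)) *\<^sub>R (ninth 4 (\<xi> t) *\<^sub>R vector_field a (?P (\<xi> t)))) (at t)"
      using \<xi>[of t] phase_point_deriv[OF D pos]
      by (intro vector_diff_chain_at) (simp_all add: has_real_derivative_iff_has_vector_derivative)
    then show ?thesis using ninth_pos[of 4 "\<xi> t"] by simp
  qed
  moreover have "?P x \<in> phase_space" for x
    using pos[of x] ninth_pos[of 3 x] arctan_bounded[of x]
    by (auto simp: phase_space_def phase_point_def)
  ultimately have "global_solution a (?P \<circ> \<xi>)"
    by (simp add: global_solution_def)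
  moreover have P_lim: "(?P \<longlongrightarrow> (1, 0, 0, l)) F"
    if scl: "((\<lambda>x. 1 / scl x) \<longlongrightarrow> 0) F" and l: "(arctan \<longlongrightarrow> l) F" for F l
  proof -
    obtain K where K: "\<And>x. \<bar>fst (?P x) - 1\<bar> \<le> K / scl x" "\<And>x. \<bar>fst (snd (?P x))\<bar> \<le> K / scl x"
      "\<And>x. \<bar>fst (snd (snd (?P x)))\<bar> \<le> K / scl x"
      using phase_point_asymptotics[OF near] by metis
    have K0: "((\<lambda>x. K / scl x) \<longlongrightarrow> 0) F"
      using tendsto_mult[OF tendsto_const[of K] scl] by simp
    have to0: "(f \<longlongrightarrow> 0) F" if "\<And>x. \<bar>f x\<bar> \<le> K / scl x" for f :: "real \<Rightarrow> real"
      by (rule Lim_null_comparison[OF _ K0]) (use that in auto)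
    have "((\<lambda>x. fst (?P x)) \<longlongrightarrow> 1) F"
      using to0[of "\<lambda>x. fst (?P x) - 1"] K(1) by (simp add: LIM_zero_iff)
    moreover have "((\<lambda>x. fst (snd (?P x))) \<longlongrightarrow> 0) F" "((\<lambda>x. fst (snd (snd (?P x)))) \<longlongrightarrow> 0) F"
      by (rule to0[OF K(2)], rule to0[OF K(3)])
    ultimately have "((\<lambda>x. (fst (?P x), fst (snd (?P x)), fst (snd (snd (?P x))), arctan x)) \<longlongrightarrow> (1, 0, 0, l)) F"
      using l by (intro tendsto_Pair)
    then show ?thesis by (simp add: phase_point_def[abs_def])
  qed
  have "((\<lambda>x. 1 / scl x) \<longlongrightarrow> 0) at_top" "((\<lambda>x. 1 / scl x) \<longlongrightarrow> 0) at_bot"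
    unfolding scl_def by real_asymp+
  then have "(?P \<longlongrightarrow> p_plus) at_top" "(?P \<longlongrightarrow> p_minus) at_bot"
    using P_lim[OF _ tendsto_arctan_at_top] P_lim[OF _ tendsto_arctan_at_bot]
    by (simp_all add: p_plus_def p_minus_def)
  then have "((?P \<circ> \<xi>) \<longlongrightarrow> p_plus) at_top" "((?P \<circ> \<xi>) \<longlongrightarrow> p_minus) at_bot"
    using lim by (auto simp: o_def intro: filterlim_compose)
  ultimately show ?thesis
    unfolding heteroclinic_connection_def by blast
qed

end
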